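(* Let $f,g_1,\ldots,g_m\in\mathbb{R}[\mathbf{x}]$ with $\mathbf{x}=(x_1,\ldots,x_d)$, let $\mathbf{K}:=\{\mathbf{x}\in\mathbb{R}^d: g_j(\mathbf{x})\geq 0,\ j=1,\ldots,m\}$, and consider the polynomial optimization problem $\mathbf{P}:\ f^*=\min_{\mathbf{x}}\{f(\mathbf{x}):\mathbf{x}\in\mathbf{K}\}$. Let $d_j:=\lceil\deg(g_j)/2\rceil$ for $j=1,\ldots,m$ and $v:=\max\{d_1,\ldots,d_m\}$. Let $n$ be such that $n\geq v$ and $2n-1\geq\deg(f)$, and let $\boldsymbol{\phi}^n=(\phi^n_{\boldsymbol{\alpha}})_{\boldsymbol{\alpha}\in\mathbb{N}^d_{2n}}$ be an optimal solution of the degree-$n$ semidefinite relaxation $\mathbf{Q}_n$ of $\mathbf{P}$, whose optimal value is $\rho_n$ and whose definition is recalled in the context. (i) If $\mathrm{rank}(\mathbf{M}_n(\boldsymbol{\phi}^n))\leq n-v+1$, then $\phi^n(f)=f^*$, that is, $\rho_n=f^*$ and the relaxation $\mathbf{Q}_n$ is exact. (ii) Assume in addition (to the rank condition in (i)) that $\deg(f)\leq 2$ and $\deg(g_j)\leq 2$ for all $j$, so that $v=1$ (and $\mathbf{P}$ is a quadratically constrained quadratic problem). Then one may recover from $\boldsymbol{\phi}^n$ a probability measure supported on global minimizers of $\mathbf{P}$ (e.g., via the extraction procedure recalled in the context).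
   Context: Notation: $\mathbb{N}^d_k:=\{\boldsymbol{\alpha}\in\mathbb{N}^d: |\boldsymbol{\alpha}|=\sum_i\alpha_i\leq k\}$; $\mathbb{R}[\mathbf{x}]_k$ is the space of real polynomials in $d$ variables of degree at most $k$. Riesz functional: for a real sequence $\boldsymbol{\phi}=(\phi_{\boldsymbol{\alpha}})_{\boldsymbol{\alpha}\in\mathbb{N}^d_{2n}}$, the Riesz functional $\phi:\mathbb{R}[\mathbf{x}]_{2n}\to\mathbb{R}$ is the linear map $p=\sum_{\boldsymbol{\alpha}}p_{\boldsymbol{\alpha}}\mathbf{x}^{\boldsymbol{\alpha}}\mapsto \phi(p)=\sum_{\boldsymbol{\alpha}}p_{\boldsymbol{\alpha}}\phi_{\boldsymbol{\alpha}}$. Moment matrix: $\mathbf{M}_n(\boldsymbol{\phi})$ is the real symmetric matrix with rows and columns indexed by $\mathbb{N}^d_n$ and entries $\phi_{\boldsymbol{\alpha}+\boldsymbol{\beta}}$. Localizing matrix: for $g=\sum_{\boldsymbol{\gamma}}g_{\boldsymbol{\gamma}}\mathbf{x}^{\boldsymbol{\gamma}}$, $\mathbf{M}_k(g\,\boldsymbol{\phi})$ is the real symmetric matrix with rows and columns indexed by $\mathbb{N}^d_k$ and entries $\sum_{\boldsymbol{\gamma}}g_{\boldsymbol{\gamma}}\phi_{\boldsymbol{\alpha}+\boldsymbol{\beta}+\boldsymbol{\gamma}}$. $\mathbf{B}\succeq0$ means that $\mathbf{B}$ is positive semidefinite. Semidefinite relaxation: with $g_0:=1$ and $d_0:=0$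 (so that $\mathbf{M}_{n-d_0}(g_0\,\boldsymbol{\phi})=\mathbf{M}_n(\boldsymbol{\phi})$), $$\mathbf{Q}_n:\quad \rho_n=\min_{\boldsymbol{\phi}}\{\phi(f):\ \phi(1)=1;\ \mathbf{M}_{n-d_j}(g_j\,\boldsymbol{\phi})\succeq0,\ j=0,\ldots,m\},$$ where the minimum is over real sequences $\boldsymbol{\phi}=(\phi_{\boldsymbol{\alpha}})_{\boldsymbol{\alpha}\in\mathbb{N}^d_{2n}}$. $\mathbf{Q}_n$ is called exact if $\rho_n=f^*$. Extraction procedure: the standard linear-algebra procedure which, from a positive semidefinite moment matrix $\mathbf{M}_k(\boldsymbol{\mu})$ satisfying the flatness condition $\mathrm{rank}(\mathbf{M}_k(\boldsymbol{\mu}))=\mathrm{rank}(\mathbf{M}_{k-v}(\boldsymbol{\mu}))$, computes the $\mathrm{rank}(\mathbf{M}_k(\boldsymbol{\mu}))$ atoms of its atomic representing measure; here $\boldsymbol{\mu}$ may be the restriction of $\boldsymbol{\phi}^n$ to indices in $\mathbb{N}^d_{2k}$, $k\leq n$. *)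

theory Defs
  imports
    "HOL-Analysis.Finite_Function_Topology"
    "HOL-Probability.Probability"
begin

text \<open>
  Multi-indices in \<open>\<nat>\<^sup>d\<close> are vectors \<open>nat ^ 'd\<close> with \<open>d = CARD('d)\<close>, and a real polynomial
  in \<open>d\<close> variables is the finitely supported function sending a multi-index to its coefficient.
\<close>

type_synonym 'd rpoly = "(nat ^ 'd) \<Rightarrow>\<^sub>0 real"

definition mdeg :: "nat ^ 'd \<Rightarrow> nat" where
  "mdeg \<alpha> = (\<Sum>i\<in>UNIV. \<alpha> $ i)"

definition multi_indices :: "nat \<Rightarrow> (nat ^ 'd) set" where
  "multi_indices k = {\<alpha>. mdeg \<alpha> \<le> k}"

definition monomial_eval :: "nat ^ 'd \<Rightarrow> real ^ 'd \<Rightarrow> real" where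
  "monomial_eval \<alpha> x = (\<Prod>i\<in>UNIV. (x $ i) ^ (\<alpha> $ i))"

definition poly_eval :: "'d::finite rpoly \<Rightarrow> real ^ 'd \<Rightarrow> real" where
  "poly_eval p x = (\<Sum>\<alpha>\<in>Poly_Mapping.keys p. Poly_Mapping.lookup p \<alpha> * monomial_eval \<alpha> x)"

text \<open>The zero polynomial gets degree \<open>0\<close>.\<close>

definition total_degree :: "'d::finite rpoly \<Rightarrow> nat" where
  "total_degree p = Max (insert 0 (mdeg ` Poly_Mapping.keys p))"

definition half_degree :: "'d::finite rpoly \<Rightarrow> nat" where
  "half_degree p = nat \<lceil>real (total_degree p) / 2\<rceil>"

definition max_half_degree :: "(nat \<Rightarrow> 'd::finite rpoly) \<Rightarrow> nat \<Rightarrow> nat" where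
  "max_half_degree g m = Max ((\<lambda>j. half_degree (g j)) ` {1..m})"

definition feasible_set :: "(nat \<Rightarrow> 'd::finite rpoly) \<Rightarrow> nat \<Rightarrow> (real ^ 'd) set" where
  "feasible_set g m = {x. \<forall>j\<in>{1..m}. 0 \<le> poly_eval (g j) x}"

text \<open>
  Optimal values are infima in the extended reals (\<open>\<infinity>\<close> if there is no feasible point).
\<close>

definition pop_value :: "'d::finite rpoly \<Rightarrow> (nat \<Rightarrow> 'd rpoly) \<Rightarrow> nat \<Rightarrow> ereal" where
  "pop_value f g m = (INF x\<in>feasible_set g m. ereal (poly_eval f x))"

definition global_minimizer :: "'d::finite rpoly \<Rightarrow> (nat \<Rightarrow> 'd rpoly) \<Rightarrow> nat \<Rightarrow> real ^ 'd \<Rightarrow> bool" where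
  "global_minimizer f g m = is_arg_min (poly_eval f) (\<lambda>x. x \<in> feasible_set g m)"

text \<open>
  A sequence indexed by \<open>multi_indices (2 * n)\<close> is represented by a function on all
  multi-indices. Its values at multi-indices of larger degree are irrelevant: the constraints
  of the degree-\<open>n\<close> relaxation do not involve them when \<open>max_half_degree g m \<le> n\<close>, and neither
  does \<open>riesz \<phi> f\<close> when \<open>f\<close> has degree at most \<open>2 * n\<close>.
\<close>

definition riesz :: "(nat ^ 'd \<Rightarrow> real) \<Rightarrow> 'd::finite rpoly \<Rightarrow> real" where
  "riesz \<phi> p = (\<Sum>\<alpha>\<in>Poly_Mapping.keys p. Poly_Mapping.lookup p \<alpha> * \<phi> \<alpha>)"

text \<open>
  A matrix with rows and columns indexed by a finite set \<open>I\<close> is a binary function, of which only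
  the values on \<open>I \<times> I\<close> are used. In particular the size of a moment or localizing matrix is
  given by the index set at which it is used.
\<close>

definition moment_matrix :: "(nat ^ 'd \<Rightarrow> real) \<Rightarrow> nat ^ 'd \<Rightarrow> nat ^ 'd \<Rightarrow> real" where
  "moment_matrix \<phi> \<alpha> \<beta> = \<phi> (\<alpha> + \<beta>)"

definition localizing_matrix ::
    "'d::finite rpoly \<Rightarrow> (nat ^ 'd \<Rightarrow> real) \<Rightarrow> nat ^ 'd \<Rightarrow> nat ^ 'd \<Rightarrow> real" where
  "localizing_matrix g \<phi> \<alpha> \<beta> =
     (\<Sum>\<gamma>\<in>Poly_Mapping.keys g. Poly_Mapping.lookup g \<gamma> * \<phi> (\<alpha> + \<beta> + \<gamma>))"

definition psd_on :: "'i set \<Rightarrow> ('i \<Rightarrow> 'i \<Rightarrow> real) \<Rightarrow> bool" where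
  "psd_on I A \<longleftrightarrow>
     (\<forall>\<alpha>\<in>I. \<forall>\<beta>\<in>I. A \<alpha> \<beta> = A \<beta> \<alpha>) \<and>
     (\<forall>c. 0 \<le> (\<Sum>\<alpha>\<in>I. \<Sum>\<beta>\<in>I. c \<alpha> * A \<alpha> \<beta> * c \<beta>))"

text \<open>
  Column rank; the column of index \<open>\<beta>\<close> is the vector \<open>(A \<alpha> \<beta>)\<close>, \<open>\<alpha> \<in> I\<close>, written as a finitely
  supported function.
\<close>

definition rank_on :: "'i set \<Rightarrow> ('i \<Rightarrow> 'i \<Rightarrow> real) \<Rightarrow> nat" where
  "rank_on I A = dim ((\<lambda>\<beta>. \<Sum>\<alpha>\<in>I. Poly_Mapping.single \<alpha> (A \<alpha> \<beta>)) ` I)"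

definition moment_rank :: "nat \<Rightarrow> (nat ^ 'd \<Rightarrow> real) \<Rightarrow> nat" where
  "moment_rank k \<phi> = rank_on (multi_indices k) (moment_matrix \<phi>)"

text \<open>In the relaxation the constraint polynomials are extended by \<open>g\<^sub>0 = 1\<close>.\<close>

definition relaxation_feasible ::
    "nat \<Rightarrow> (nat \<Rightarrow> 'd::finite rpoly) \<Rightarrow> nat \<Rightarrow> (nat ^ 'd \<Rightarrow> real) \<Rightarrow> bool" where
  "relaxation_feasible n g m \<phi> \<longleftrightarrow>
     riesz \<phi> 1 = 1 \<and>
     (\<forall>j\<in>{0..m}. psd_on (multi_indices (n - half_degree ((g(0 := 1)) j)))
                       (localizing_matrix ((g(0 := 1)) j) \<phi>))"

definition relaxation_value :: "nat \<Rightarrow> 'd::finite rpoly \<Rightarrow> (nat \<Rightarrow> 'd rpoly) \<Rightarrow> nat \<Rightarrow> ereal" where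
  "relaxation_value n f g m = (INF \<phi>\<in>{\<phi>. relaxation_feasible n g m \<phi>}. ereal (riesz \<phi> f))"

definition relaxation_optimal ::
    "nat \<Rightarrow> 'd::finite rpoly \<Rightarrow> (nat \<Rightarrow> 'd rpoly) \<Rightarrow> nat \<Rightarrow> (nat ^ 'd \<Rightarrow> real) \<Rightarrow> bool" where
  "relaxation_optimal n f g m = is_arg_min (\<lambda>\<phi>. riesz \<phi> f) (relaxation_feasible n g m)"

text \<open>
  The flatness condition under which atoms are extracted from the moment matrix of order \<open>k\<close>, and
  the outcome of the extraction: a probability measure with as many atoms as the rank of that
  matrix whose moments of degree at most \<open>2 * k\<close> are those of \<open>\<phi>\<close>.
\<close>

definition flat_moments :: "nat \<Rightarrow> nat \<Rightarrow> (nat ^ 'd \<Rightarrow> real) \<Rightarrow> bool" where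
  "flat_moments v k \<phi> \<longleftrightarrow> v \<le> k \<and> moment_rank k \<phi> = moment_rank (k - v) \<phi>"

definition atomic_representing :: "nat \<Rightarrow> (nat ^ 'd \<Rightarrow> real) \<Rightarrow> (real ^ 'd) pmf \<Rightarrow> bool" where
  "atomic_representing k \<phi> \<mu> \<longleftrightarrow>
     finite (set_pmf \<mu>) \<and> card (set_pmf \<mu>) = moment_rank k \<phi> \<and>
     (\<forall>\<alpha>\<in>multi_indices (2 * k). \<phi> \<alpha> = measure_pmf.expectation \<mu> (monomial_eval \<alpha>))"

end

theory Submission
  imports Defs "HOL-Computational_Algebra.Fundamental_Theorem_Algebra"
begin

text \<open>
  Let \<open>r k\<close> be the rank of the moment matrix of order \<open>k\<close>; it is the dimension of the polynomials of
  degree at most \<open>k\<close> modulo the kernel of the form \<open>(p, q) \<mapsto> \<phi>(p q)\<close>. On the quotient \<open>V\<close> of the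
  polynomials of degree at most \<open>n - 1\<close>, multiplication by a variable followed by orthogonal projection
  is self-adjoint. These operators commute if \<open>r (n - 1) = r n\<close>, and also if
  \<open>r (n - 1) \<le> r (n - 2) + 1\<close>, since their commutators are antisymmetric and vanish on polynomials of
  degree at most \<open>n - 2\<close>. As in Gauss quadrature, a joint eigenbasis then gives a measure with
  \<open>r (n - 1)\<close> atoms that has the moments of \<open>\<phi>\<close> up to degree \<open>2 n - 1\<close>, and up to \<open>2 n\<close> if
  \<open>r (n - 1) = r n\<close>.

  An equality \<open>r k = r (k + 1)\<close> propagates up to \<open>r (n - 1)\<close>, so \<open>r\<close> grows strictly until it reaches
  \<open>r (n - 1)\<close> at some \<open>s\<close>. The rank bound therefore yields the commutation criterion and \<open>s \<le> n - v\<close>,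
  with \<open>r (n - 1) = r n\<close> in case of equality. As \<open>r s\<close> is the number of atoms, polynomials of degree at
  most \<open>s\<close> interpolate at the atoms, and the localizing matrices show that the atoms are feasible.
\<close>

section \<open>Symmetric bilinear forms and self-adjoint operators\<close>

definition poly_op :: "real poly \<Rightarrow> ('v::real_vector \<Rightarrow> 'v) \<Rightarrow> 'v \<Rightarrow> 'v" where
  "poly_op p T v = (\<Sum>i\<le>degree p. coeff p i *\<^sub>R (T ^^ i) v)"

lemma poly_op_eq_sum:
  assumes "degree p \<le> N"
  shows "poly_op p T v = (\<Sum>i\<le>N. coeff p i *\<^sub>R (T ^^ i) v)"
  unfolding poly_op_def using assms
  by (intro sum.mono_neutral_left) (auto simp: coeff_eq_0)

lemma poly_op_add: "poly_op (p + q) T v = poly_op p T v + poly_op q T v"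
proof -
  define N where "N = max (degree p) (degree q)"
  have "degree (p + q) \<le> N" "degree p \<le> N" "degree q \<le> N"
    unfolding N_def by (auto simp: degree_add_le)
  then show ?thesis
    by (simp add: poly_op_eq_sum[where N = N] scaleR_add_left sum.distrib)
qed

lemma poly_op_smult: "poly_op (smult c p) T v = c *\<^sub>R poly_op p T v"
proof -
  have "degree (smult c p) \<le> degree p" by simp
  then show ?thesis
    by (simp add: poly_op_eq_sum[where N = "degree p"] scaleR_sum_right)
qed

lemma poly_op_0 [simp]: "poly_op 0 T v = 0"
  by (simp add: poly_op_def)

lemma poly_op_pCons:
  assumes "linear T"
  shows "poly_op (pCons a p) T v = a *\<^sub>R v + T (poly_op p T v)"
proof -
  have "degree (pCons a p) \<le> Suc (degree p)" by (simp add: degree_pCons_le)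
  then have "poly_op (pCons a p) T v =
      (\<Sum>i\<le>Suc (degree p). coeff (pCons a p) i *\<^sub>R (T ^^ i) v)"
    by (rule poly_op_eq_sum)
  also have "\<dots> = a *\<^sub>R v + (\<Sum>i\<le>degree p. coeff p i *\<^sub>R T ((T ^^ i) v))"
    by (subst sum.atMost_Suc_shift) simp
  also have "(\<Sum>i\<le>degree p. coeff p i *\<^sub>R T ((T ^^ i) v)) = T (poly_op p T v)"
    unfolding poly_op_def using assms by (simp add: linear_sum linear_scale)
  finally show ?thesis .
qed

lemma poly_op_mult:
  assumes "linear T"
  shows "poly_op (p * q) T v = poly_op p T (poly_op q T v)"
proof (induction p)
  case (pCons a p)
  have "poly_op (pCons a p * q) T v = poly_op (smult a q + pCons 0 (p * q)) T v"
    by simp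
  also have "\<dots> = a *\<^sub>R poly_op q T v + T (poly_op p T (poly_op q T v))"
    using assms pCons.IH by (simp add: poly_op_add poly_op_smult poly_op_pCons)
  finally show ?case using assms by (simp add: poly_op_pCons)
qed simp

lemma poly_op_mem:
  assumes "subspace W" "T ` W \<subseteq> W" "v \<in> W"
  shows "poly_op p T v \<in> W"
proof -
  have "(T ^^ i) v \<in> W" for i
    using assms(2,3) by (induction i) auto
  then show ?thesis
    unfolding poly_op_def using assms(1) by (intro subspace_sum subspace_scale)
qed

text \<open>The \<open>card S + 1\<close> vectors \<open>(T ^^ i) v\<close> with
  \<open>i \<le> card S\<close> lie in a span of \<open>card S\<close> vectors. As linear dependence
  is a property of sets, repetitions among them are treated separately.\<close>

lemma ex_annihilating_poly:
  fixes T :: "'v::real_vector \<Rightarrow> 'v"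
  assumes "finite S" "\<And>i. (T ^^ i) v \<in> span S"
  shows "\<exists>p. p \<noteq> 0 \<and> poly_op p T v = 0"
proof -
  define N where "N = card S"
  define h where "h i = (T ^^ i) v" for i
  show ?thesis
  proof (cases "inj_on h {..N}")
    case False
    then obtain i j where ij: "i \<noteq> j" "h i = h j"
      by (auto simp: inj_on_def)
    define p :: "real poly" where "p = monom 1 i + monom (-1) j"
    have "degree p \<le> max i j"
      unfolding p_def by (meson degree_add_le degree_monom_le le_trans max.cobounded1 max.cobounded2)
    then have "poly_op p T v = (\<Sum>k\<le>max i j. coeff p k *\<^sub>R h k)"
      by (simp add: poly_op_eq_sum h_def)
    also have "\<dots> = (\<Sum>k\<le>max i j. (if k = i then h k else 0) - (if k = j then h k else 0))"
      by (intro sum.cong) (auto simp: p_def)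
    also have "\<dots> = 0"
      using ij by (simp add: sum_subtractf)
    finally have "poly_op p T v = 0" .
    moreover have "coeff p i \<noteq> 0" using ij by (simp add: p_def)
    then have "p \<noteq> 0" by auto
    ultimately show ?thesis by blast
  next
    case True
    have "dependent (h ` {..N})"
    proof (rule ccontr)
      assume "independent (h ` {..N})"
      then have "card (h ` {..N}) \<le> card S"
        using independent_span_bound[OF assms(1)] assms(2) unfolding h_def by blast
      with True show False by (simp add: card_image N_def)
    qed
    then obtain u where u: "\<exists>x\<in>h ` {..N}. u x \<noteq> 0" "(\<Sum>x\<in>h ` {..N}. u x *\<^sub>R x) = 0"
      by (auto simp: dependent_finite)
    define p where "p = (\<Sum>i\<le>N. monom (u (h i)) i)"
    have co: "coeff p i = (if i \<le> N then u (h i) else 0)" for i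
      by (auto simp: p_def coeff_sum)
    then have "degree p \<le> N" by (simp add: degree_le)
    then have "poly_op p T v = (\<Sum>i\<le>N. u (h i) *\<^sub>R h i)"
      by (simp add: poly_op_eq_sum co h_def)
    also have "\<dots> = 0"
      using u(2) True by (simp add: sum.reindex)
    finally have "poly_op p T v = 0" .
    moreover obtain i where "i \<le> N" "u (h i) \<noteq> 0" using u(1) by auto
    then have "p \<noteq> 0" using co[of i] by auto
    ultimately show ?thesis by blast
  qed
qed

section \<open>Real polynomials at complex points\<close>

lemma map_poly_of_real_add:
  "map_poly complex_of_real (p + q) = map_poly of_real p + map_poly of_real q"
  by (intro poly_eqI) (simp add: coeff_map_poly)

lemma map_poly_of_real_mult:
  "map_poly complex_of_real (p * q) = map_poly of_real p * map_poly of_real q"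
  by (induction p) (simp_all add: map_poly_pCons map_poly_of_real_add map_poly_smult)

lemma poly_map_poly_of_real: "poly (map_poly complex_of_real p) (of_real x) = of_real (poly p x)"
  by (induction p) (simp_all add: map_poly_pCons)

text \<open>No definiteness is assumed: the form of a truncated sequence is in general only
  semidefinite, and this only on polynomials of bounded degree. Positivity enters as a hypothesis on
  a subspace.\<close>

locale symmetric_form =
  fixes B :: "'v::real_vector \<Rightarrow> 'v \<Rightarrow> real"
  assumes bilinear: "bilinear B" and sym: "B x y = B y x"
begin

lemmas form_simps = bilinear_ladd[OF bilinear] bilinear_radd[OF bilinear]
  bilinear_lsub[OF bilinear] bilinear_rsub[OF bilinear] bilinear_lmul[OF bilinear]
  bilinear_rmul[OF bilinear] bilinear_lzero[OF bilinear] bilinear_rzero[OF bilinear]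

lemma linear_right: "linear (B x)"
  using bilinear by (simp add: bilinear_def)

lemma sum_right: "B x (sum g A) = (\<Sum>a\<in>A. B x (g a))"
  using linear_sum[OF linear_right] by blast

lemma sum_left: "B (sum g A) x = (\<Sum>a\<in>A. B (g a) x)"
  by (simp add: sym[of _ x] sum_right)

lemma null_on_span:
  assumes "\<And>y. y \<in> S \<Longrightarrow> B x y = 0" "z \<in> span S"
  shows "B x z = 0"
  using assms(2,1) linear_eq_0_on_span[OF linear_right] by blast

text \<open>For null \<open>x\<close> the quadratic form at \<open>y + t x\<close> is affine in
  \<open>t\<close> with slope \<open>2 * B x y\<close>, so a nonzero slope would make it negative
  somewhere.\<close>

lemma cauchy_schwarz_null:
  assumes "subspace R" "\<And>x. x \<in> R \<Longrightarrow> 0 \<le> B x x" "x \<in> R" "B x x = 0" "y \<in> R"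
  shows "B x y = 0"
proof (rule ccontr)
  assume nz: "B x y \<noteq> 0"
  define t where "t = - (B y y + 1) / (2 * B x y)"
  have "y + t *\<^sub>R x \<in> R" using assms by (simp add: subspace_add subspace_scale)
  then have "0 \<le> B (y + t *\<^sub>R x) (y + t *\<^sub>R x)" by (rule assms(2))
  also have "\<dots> = B y y + 2 * t * B x y"
    by (simp add: form_simps assms(4) sym[of y x])
  also have "\<dots> = -1" using nz by (simp add: t_def field_simps)
  finally show False by simp
qed

text \<open>A polynomial of least degree annihilating a nonzero vector has a complex root. If the
  root is real, the cofactor of its linear factor sends the vector to an eigenvector. A nonreal root
  contradicts positivity.\<close>

lemma selfadjoint_eigenvector:
  assumes lin: "linear T" and W: "subspace W" "finite S" "W \<subseteq> span S" and inv: "T ` W \<subseteq> W"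
    and adj: "\<And>x y. x \<in> W \<Longrightarrow> y \<in> W \<Longrightarrow> B (T x) y = B x (T y)"
    and pos: "\<And>x. x \<in> W \<Longrightarrow> x \<noteq> 0 \<Longrightarrow> 0 < B x x"
    and v: "v \<in> W" "v \<noteq> 0"
  shows "\<exists>w \<kappa>. w \<in> W \<and> w \<noteq> 0 \<and> T w = \<kappa> *\<^sub>R w"
proof -
  define P where "P k \<longleftrightarrow> (\<exists>p w. p \<noteq> 0 \<and> degree p = k \<and> w \<in> W \<and> w \<noteq> 0 \<and> poly_op p T w = 0)" for k
  have "(T ^^ i) v \<in> W" for i
    using inv v by (induction i) auto
  then have "\<exists>p. p \<noteq> 0 \<and> poly_op p T v = 0"
    using W by (intro ex_annihilating_poly[of S]) auto
  then have "\<exists>k. P k" using v unfolding P_def by blast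
  then have "P (LEAST k. P k)" by (rule LeastI_ex)
  then obtain p u where p: "p \<noteq> 0" "degree p = (LEAST k. P k)" "u \<in> W" "u \<noteq> 0" "poly_op p T u = 0"
    unfolding P_def by blast
  have minimal: "poly_op s T u \<noteq> 0" if "p = q * s" "0 < degree q" for q s
  proof
    assume "poly_op s T u = 0"
    moreover have nz: "s \<noteq> 0" "q \<noteq> 0" using p(1) that by auto
    ultimately have "P (degree s)" using p unfolding P_def by blast
    then have "degree p \<le> degree s" unfolding p(2) by (rule Least_le)
    with that nz show False by (simp add: degree_mult_eq)
  qed
  have "degree p \<noteq> 0"
  proof
    assume "degree p = 0"
    then obtain a where "p = [:a:]" by (auto elim: degree_eq_zeroE)
    with p show False by (simp add: poly_op_def)
  qed
  define pc where "pc = map_poly complex_of_real p"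
  have "degree pc = degree p" unfolding pc_def by (simp add: degree_map_poly)
  with \<open>degree p \<noteq> 0\<close> have "\<not> constant (poly pc)" by (simp add: constant_degree)
  then obtain z where z: "poly pc z = 0" using fundamental_theorem_of_algebra by blast
  define a where "a = Re z"
  define b where "b = Im z"
  show ?thesis
  proof (cases "b = 0")
    case True
    then have "z = of_real a" by (simp add: a_def b_def complex_eq_iff)
    with z have "poly p a = 0" by (simp add: pc_def poly_map_poly_of_real)
    then obtain s where s: "p = [:- a, 1:] * s" by (auto simp: poly_eq_0_iff_dvd dvd_def)
    define w where "w = poly_op s T u"
    have "w \<noteq> 0" unfolding w_def by (rule minimal[OF s]) simp
    moreover have "w \<in> W" unfolding w_def by (intro poly_op_mem W inv p)
    moreover have "poly_op [:- a, 1:] T w = 0"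
      using p(5) poly_op_mult[OF lin] s w_def by metis
    then have "T w = a *\<^sub>R w" using linear_0[OF lin] by (simp add: poly_op_pCons[OF lin])
    ultimately show ?thesis by blast
  next
    case False
    \<comment> \<open>The real quadratic with roots \<open>z\<close> and its conjugate. It divides
      \<open>p\<close>, since a remainder of degree at most 1 with a nonreal root is zero.\<close>
    define q where "q = [:a\<^sup>2 + b\<^sup>2, - 2 * a, 1:]"
    define r where "r = p mod q"
    have qz: "poly (map_poly complex_of_real q) z = 0"
      by (simp add: q_def map_poly_pCons complex_eq_iff a_def b_def power2_eq_square algebra_simps)
    have "p = q * (p div q) + r" by (simp add: r_def)
    then have "pc = map_poly complex_of_real q * map_poly complex_of_real (p div q) + map_poly complex_of_real r"
      unfolding pc_def by (metis map_poly_of_real_add map_poly_of_real_mult)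
    then have rz: "poly (map_poly complex_of_real r) z = 0" using z qz by simp
    have "degree r < 2"
    proof -
      have "q \<noteq> 0" "degree q = 2" by (simp_all add: q_def)
      then show ?thesis using degree_mod_less[of q p] by (auto simp: r_def)
    qed
    then have "coeff r i = 0" if "i \<ge> 2" for i using that by (simp add: coeff_eq_0)
    then have r: "r = [:coeff r 0, coeff r 1:]"
      by (intro poly_eqI) (auto simp: coeff_pCons split: nat.splits)
    define c0 where "c0 = coeff r 0"
    define c1 where "c1 = coeff r 1"
    have r': "r = [:c0, c1:]" using r unfolding c0_def c1_def .
    have "complex_of_real c0 + z * complex_of_real c1 = 0"
      using rz unfolding r' by (simp add: map_poly_pCons)
    then have "c1 = 0" "c0 = 0" using False by (auto simp: complex_eq_iff b_def)
    then have s: "p = q * (p div q)" using \<open>p = q * (p div q) + r\<close> r' by simp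
    define w where "w = poly_op (p div q) T u"
    have "w \<noteq> 0" unfolding w_def by (rule minimal[OF s]) (simp add: q_def)
    moreover have wW: "w \<in> W" unfolding w_def by (intro poly_op_mem W inv p)
    ultimately have "0 < B w w" by (rule pos[rotated])
    have "poly_op q T w = 0"
      using p(5) poly_op_mult[OF lin] s w_def by metis
    then have eq: "(a\<^sup>2 + b\<^sup>2) *\<^sub>R w + T (T w - (2 * a) *\<^sub>R w) = 0"
      using linear_0[OF lin] by (simp add: poly_op_pCons[OF lin] q_def algebra_simps)
    \<comment> \<open>\<open>q(T) w = 0\<close> says \<open>(T - a)^2 w = - b^2 w\<close>, so
      self-adjointness gives \<open>B y y = - b^2 B w w\<close> for
      \<open>y = (T - a) w\<close>.\<close>
    define y where "y = T w - a *\<^sub>R w"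
    have "T w \<in> W" using wW inv by auto
    then have yW: "y \<in> W"
      unfolding y_def using wW W(1) by (intro subspace_diff subspace_scale)
    have Ty: "T y - a *\<^sub>R y = - (b\<^sup>2) *\<^sub>R w"
    proof -
      have "T y - a *\<^sub>R y + b\<^sup>2 *\<^sub>R w = (a\<^sup>2 + b\<^sup>2) *\<^sub>R w + T (T w - (2 * a) *\<^sub>R w)"
        unfolding y_def by (simp add: linear_diff[OF lin] linear_scale[OF lin] algebra_simps power2_eq_square scaleR_2[symmetric] mult.commute)
      then show ?thesis using eq by (simp add: eq_neg_iff_add_eq_0)
    qed
    have "B y y = B w (T y - a *\<^sub>R y)"
      using adj[OF wW yW] by (subst (1) y_def) (simp add: form_simps)
    also have "\<dots> = - (b\<^sup>2) * B w w" unfolding Ty by (simp only: form_simps) simp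
    also have "\<dots> < 0" using False \<open>0 < B w w\<close> by simp
    finally have "B y y < 0" .
    moreover have "0 \<le> B y y" using pos[OF yW] by (cases "y = 0") (auto simp: form_simps)
    ultimately show ?thesis by simp
  qed
qed

text \<open>By commutativity an eigenspace of one operator in \<open>W\<close> is invariant under
  the others, so the induction continues inside it.\<close>

lemma joint_eigenvector:
  assumes "finite J" and "finite S"
    and "\<And>i. i \<in> J \<Longrightarrow> linear (T i)"
    and "subspace W" "W \<subseteq> span S" "\<And>i. i \<in> J \<Longrightarrow> T i ` W \<subseteq> W"
    and "\<And>i x y. i \<in> J \<Longrightarrow> x \<in> W \<Longrightarrow> y \<in> W \<Longrightarrow> B (T i x) y = B x (T i y)"
    and "\<And>i j x. i \<in> J \<Longrightarrow> j \<in> J \<Longrightarrow> x \<in> W \<Longrightarrow> T i (T j x) = T j (T i x)"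
    and "\<And>x. x \<in> W \<Longrightarrow> x \<noteq> 0 \<Longrightarrow> 0 < B x x"
    and "W \<noteq> {0}"
  shows "\<exists>w\<in>W. w \<noteq> 0 \<and> (\<forall>i\<in>J. \<exists>\<kappa>. T i w = \<kappa> *\<^sub>R w)"
  using assms
proof (induction J arbitrary: W rule: finite_induct)
  case empty
  then show ?case using subspace_0[of W] by auto
next
  case (insert i J)
  obtain v where "v \<in> W" "v \<noteq> 0" using insert.prems(3,9) subspace_0[of W] by blast
  then obtain w0 \<kappa> where w0: "w0 \<in> W" "w0 \<noteq> 0" "T i w0 = \<kappa> *\<^sub>R w0"
    using selfadjoint_eigenvector[of "T i" W S v] insert.prems by auto
  define W' where "W' = {w \<in> W. T i w = \<kappa> *\<^sub>R w}"
  have sub: "subspace W'"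
    using insert.prems(2)[of i] insert.prems(3)
    by (auto simp: W'_def subspace_def linear_0 linear_add linear_scale algebra_simps)
  have inv: "T j ` W' \<subseteq> W'" if "j \<in> J" for j
  proof (safe, unfold W'_def, safe)
    fix x assume x: "x \<in> W" "T i x = \<kappa> *\<^sub>R x"
    show "T j x \<in> W" using insert.prems(5)[of j] that x by auto
    have "T i (T j x) = T j (T i x)" using insert.prems(7)[of i j x] that x by auto
    then show "T i (T j x) = \<kappa> *\<^sub>R T j x"
      using x insert.prems(2)[of j] that by (simp add: linear_scale)
  qed
  have "\<exists>w\<in>W'. w \<noteq> 0 \<and> (\<forall>j\<in>J. \<exists>\<kappa>. T j w = \<kappa> *\<^sub>R w)"
  proof (rule insert.IH)
    show "W' \<noteq> {0}" using w0 by (auto simp: W'_def)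
  qed (use insert.prems sub inv in \<open>auto simp: W'_def\<close>)
  then show ?case by (auto simp: W'_def)
qed

section \<open>Orthonormal sets and orthogonal projection\<close>

definition orthonormal :: "'v set \<Rightarrow> bool" where
  "orthonormal E \<longleftrightarrow> (\<forall>x\<in>E. \<forall>y\<in>E. B x y = (if x = y then 1 else 0))"

definition proj :: "'v set \<Rightarrow> 'v \<Rightarrow> 'v" where
  "proj E x = (\<Sum>e\<in>E. B e x *\<^sub>R e)"

lemma linear_proj: "linear (proj E)"
  unfolding proj_def
  by (intro linearI) (simp_all add: form_simps algebra_simps sum.distrib scaleR_sum_right)

lemma proj_mem: "proj E x \<in> span E"
  unfolding proj_def by (intro span_sum span_scale span_base)

lemma orthonormal_coeff:
  assumes "orthonormal E" "finite E" "e \<in> E"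
  shows "B e (\<Sum>x\<in>E. c x *\<^sub>R x) = c e"
proof -
  have "B e (\<Sum>x\<in>E. c x *\<^sub>R x) = (\<Sum>x\<in>E. if x = e then c x else 0)"
    unfolding sum_right using assms by (intro sum.cong) (auto simp: form_simps orthonormal_def)
  then show ?thesis using assms by simp
qed

lemma proj_coeff:
  assumes "orthonormal E" "finite E" "e \<in> E"
  shows "B e (proj E x) = B e x"
  unfolding proj_def by (rule orthonormal_coeff[OF assms])

lemma proj_orth:
  assumes "orthonormal E" "finite E" "z \<in> span E"
  shows "B (x - proj E x) z = 0"
proof (rule null_on_span[OF _ assms(3)])
  fix y assume "y \<in> E"
  then have "B y (x - proj E x) = 0" by (simp add: form_simps proj_coeff[OF assms(1,2)])
  then show "B (x - proj E x) y = 0" by (simp add: sym)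
qed

lemma proj_id:
  assumes "orthonormal E" "finite E" "x \<in> span E"
  shows "proj E x = x"
proof -
  obtain c where c: "x = (\<Sum>e\<in>E. c e *\<^sub>R e)"
    using assms by (auto simp: span_finite)
  then show ?thesis
    unfolding proj_def using orthonormal_coeff[OF assms(1,2)] by (auto intro: sum.cong)
qed

lemma orthonormal_independent:
  assumes "orthonormal E" "finite E"
  shows "independent E"
proof
  assume "dependent E"
  then obtain u e where u: "e \<in> E" "u e \<noteq> 0" "(\<Sum>v\<in>E. u v *\<^sub>R v) = 0"
    using assms by (auto simp: dependent_finite)
  then show False using orthonormal_coeff[OF assms u(1), of u] by (simp add: form_simps)
qed

text \<open>\<open>B x x\<close> is the sum of the squared coefficients of \<open>x\<close>. Spans
  of orthonormal sets thus serve as models of quotients by null vectors.\<close>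

lemma orthonormal_pos:
  assumes "orthonormal E" "finite E" "x \<in> span E" "x \<noteq> 0"
  shows "0 < B x x"
proof -
  have eq: "B x x = (\<Sum>e\<in>E. (B e x)\<^sup>2)"
    by (subst (2) proj_id[OF assms(1-3), symmetric])
      (simp add: proj_def sum_right form_simps sym[of x] power2_eq_square)
  have "\<exists>e\<in>E. B e x \<noteq> 0"
  proof (rule ccontr)
    assume "\<not> ?thesis"
    then have "proj E x = 0" by (simp add: proj_def)
    with assms proj_id[OF assms(1-3)] show False by simp
  qed
  then show ?thesis unfolding eq using assms(2) by (auto intro: sum_pos2)
qed

lemma orthonormal_insert:
  assumes "orthonormal E" "B x x = 1" "\<And>e. e \<in> E \<Longrightarrow> B e x = 0"
  shows "orthonormal (insert x E)"
  using assms sym unfolding orthonormal_def by (metis insert_iff)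

text \<open>An orthonormal set of joint eigenvectors of maximal size spans: its orthogonal
  complement is invariant, and a joint eigenvector found there would enlarge the set.\<close>

lemma orthonormal_eigenbasis:
  fixes T :: "'i::finite \<Rightarrow> 'v \<Rightarrow> 'v"
  assumes E0: "orthonormal E0" "finite E0"
    and lin: "\<And>i. linear (T i)"
    and inv: "\<And>i. T i ` span E0 \<subseteq> span E0"
    and adj: "\<And>i x y. x \<in> span E0 \<Longrightarrow> y \<in> span E0 \<Longrightarrow> B (T i x) y = B x (T i y)"
    and comm: "\<And>i j x. x \<in> span E0 \<Longrightarrow> T i (T j x) = T j (T i x)"
  shows "\<exists>E. orthonormal E \<and> finite E \<and> span E = span E0 \<and> card E = card E0 \<and>
           (\<forall>e\<in>E. \<forall>i. \<exists>\<kappa>. T i e = \<kappa> *\<^sub>R e)"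
proof -
  define P where "P E \<longleftrightarrow> orthonormal E \<and> finite E \<and> E \<subseteq> span E0 \<and>
      (\<forall>e\<in>E. \<forall>i. \<exists>\<kappa>. T i e = \<kappa> *\<^sub>R e)" for E
  have "card E < Suc (card E0)" if "P E" for E
    using that independent_span_bound[OF E0(2)] orthonormal_independent by (auto simp: P_def less_Suc_eq_le)
  moreover have "P {}" by (simp add: P_def orthonormal_def)
  ultimately obtain E where E: "P E" and max: "\<And>E'. P E' \<Longrightarrow> card E' \<le> card E"
    using ex_has_greatest_nat[of P "{}" card "Suc (card E0)"] by blast
  define W where "W = {x \<in> span E0. \<forall>e\<in>E. B e x = 0}"
  have "W = {0}"
  proof (rule ccontr)
    assume nz: "W \<noteq> {0}"
    have sub: "subspace W"
      unfolding W_def subspace_def by (auto simp: form_simps span_0 span_add span_scale)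
    have invW: "T i ` W \<subseteq> W" for i
    proof (safe, unfold W_def, safe)
      fix x assume x: "x \<in> span E0" "\<forall>e\<in>E. B e x = 0"
      show "T i x \<in> span E0" using inv x by auto
      fix e assume e: "e \<in> E"
      then obtain \<kappa> where "T i e = \<kappa> *\<^sub>R e" using E unfolding P_def by blast
      moreover have "B e (T i x) = B (T i e) x" using adj[of e x i] e E x by (auto simp: P_def)
      ultimately show "B e (T i x) = 0" using x e by (simp add: form_simps)
    qed
    have "\<exists>w\<in>W. w \<noteq> 0 \<and> (\<forall>i\<in>UNIV. \<exists>\<kappa>. T i w = \<kappa> *\<^sub>R w)"
      by (rule joint_eigenvector[of UNIV E0])
        (use nz sub invW lin adj comm E0 orthonormal_pos[OF E0] in \<open>auto simp: W_def\<close>)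
    then obtain w where w: "w \<in> W" "w \<noteq> 0" "\<And>i. \<exists>\<kappa>. T i w = \<kappa> *\<^sub>R w" by auto
    have wpos: "0 < B w w" using w orthonormal_pos[OF E0] by (auto simp: W_def)
    define e where "e = (1 / sqrt (B w w)) *\<^sub>R w"
    have "B e e = 1" using wpos by (simp add: e_def form_simps power2_eq_square[symmetric])
    moreover have orth: "B e' e = 0" if "e' \<in> E" for e' using that w by (auto simp: e_def W_def form_simps)
    ultimately have "orthonormal (insert e E)" using E by (intro orthonormal_insert) (auto simp: P_def)
    moreover have "\<exists>\<kappa>. T i e = \<kappa> *\<^sub>R e" for i
      using w(3)[of i] linear_scale[OF lin[of i]] by (auto simp: e_def)
    moreover have "e \<in> span E0" using w by (auto simp: e_def W_def intro: span_scale)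
    ultimately have "P (insert e E)" using E by (auto simp: P_def)
    moreover have "e \<notin> E" using orth[of e] \<open>B e e = 1\<close> by auto
    ultimately show False using max[of "insert e E"] E by (auto simp: P_def)
  qed
  have "span E = span E0"
  proof
    show "span E \<subseteq> span E0" using E by (simp add: P_def span_minimal)
    show "span E0 \<subseteq> span E"
    proof
      fix x assume x: "x \<in> span E0"
      have EE: "orthonormal E" "finite E" using E by (auto simp: P_def)
      have "x - proj E x \<in> W"
        using x \<open>span E \<subseteq> span E0\<close> proj_mem[of E x] proj_coeff[OF EE]
        by (auto simp: W_def form_simps intro: span_diff)
      then show "x \<in> span E" using \<open>W = {0}\<close> proj_mem[of E x] by auto
    qed
  qed
  moreover have "card E = card E0"
    using calculation E E0 orthonormal_independent dim_span_eq_card_independent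
    by (metis P_def)
  ultimately show ?thesis using E by (auto simp: P_def)
qed

text \<open>Spanning modulo null vectors: an element of \<open>U\<close> may differ from its
  projection, but only by a vector of norm zero.\<close>

definition complete_for :: "'v set \<Rightarrow> 'v set \<Rightarrow> bool" where
  "complete_for E U \<longleftrightarrow> (\<forall>x\<in>U. B (x - proj E x) (x - proj E x) = 0)"

text \<open>The given set \<open>E\<close> is kept, so that bases for increasing degrees can be
  nested. A vector with a null remainder is skipped instead of normalized.\<close>

lemma gram_schmidt:
  assumes R: "subspace R" "\<And>x. x \<in> R \<Longrightarrow> 0 \<le> B x x"
    and "finite S" "S \<subseteq> R" "finite E" "E \<subseteq> R" "orthonormal E"
  shows "\<exists>E'. finite E' \<and> E \<subseteq> E' \<and> orthonormal E' \<and> E' \<subseteq> span (E \<union> S) \<and> complete_for E' S"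
  using assms(3,4)
proof (induction S rule: finite_induct)
  case empty
  show ?case by (intro exI[of _ E]) (use assms in \<open>auto simp: complete_for_def span_base\<close>)
next
  case (insert x S)
  then obtain F where F: "finite F" "E \<subseteq> F" "orthonormal F" "F \<subseteq> span (E \<union> S)" "complete_for F S"
    by auto
  have spR: "span (E \<union> insert x S) \<subseteq> R"
    using insert.prems assms R(1) by (intro span_minimal) auto
  have mono: "span (E \<union> S) \<subseteq> span (E \<union> insert x S)" by (intro span_mono) auto
  define u where "u = x - proj F x"
  have uF: "B e u = 0" if "e \<in> F" for e
    using proj_coeff[OF F(3,1) that] by (simp add: u_def form_simps)
  have projF: "proj F x \<in> span (E \<union> insert x S)"
    using proj_mem[of F x] span_minimal[OF F(4)] mono by auto
  then have u: "u \<in> span (E \<union> insert x S)"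
    unfolding u_def by (intro span_diff) (auto intro: span_base)
  show ?case
  proof (cases "B u u = 0")
    case True
    then have "complete_for F (insert x S)" using F(5) by (simp add: complete_for_def u_def)
    then show ?thesis using F mono by blast
  next
    case False
    then have upos: "0 < B u u" using R(2)[of u] u spR by auto
    define e where "e = (1 / sqrt (B u u)) *\<^sub>R u"
    have ee: "B e e = 1" using upos by (simp add: e_def form_simps power2_eq_square[symmetric])
    have eF: "B e' e = 0" if "e' \<in> F" for e' using uF[OF that] by (simp add: e_def form_simps)
    have on: "orthonormal (insert e F)" using F(3) ee eF by (rule orthonormal_insert)
    have "e \<notin> F" using eF[of e] ee by auto
    then have proj: "proj (insert e F) y = B e y *\<^sub>R e + proj F y" for y
      using F(1) by (simp add: proj_def)
    have "complete_for (insert e F) (insert x S)"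
      unfolding complete_for_def
    proof (intro ballI)
      fix y assume "y \<in> insert x S"
      then consider "y = x" | "y \<in> S" by auto
      then show "B (y - proj (insert e F) y) (y - proj (insert e F) y) = 0"
      proof cases
        case 1
        have "B u (proj F x) = 0"
          using null_on_span[of F u "proj F x"] uF sym proj_mem by metis
        then have "B u x = B u u" by (simp add: u_def form_simps)
        then have "B e x *\<^sub>R e = u"
          using upos by (simp add: e_def form_simps)
        then have "y - proj (insert e F) y = 0" unfolding proj 1 by (simp add: u_def)
        then show ?thesis by (simp add: form_simps)
      next
        case 2
        \<comment> \<open>The remainder of an earlier vector is null, hence orthogonal to
          \<open>e\<close>, so the new element does not change the projection of that
          vector.\<close>
        define z where "z = y - proj F y"
        have zz: "B z z = 0" using F(5) 2 by (simp add: complete_for_def z_def)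
        have "proj F y \<in> span (E \<union> insert x S)"
          using proj_mem[of F y] span_minimal[OF F(4)] mono by auto
        then have "z \<in> R" unfolding z_def using spR 2 by (meson UnI2 insertI2 span_base span_diff subsetD)
        moreover have "e \<in> R" unfolding e_def using u spR R(1) by (auto intro: subspace_scale)
        ultimately have ze: "B z e = 0" using cauchy_schwarz_null[OF R(1) R(2) _ zz] by blast
        have "B (proj F y) e = 0"
          using null_on_span[of F e "proj F y"] eF sym proj_mem by metis
        with ze have "B e y = 0" by (simp add: z_def form_simps sym[of e])
        then show ?thesis using zz by (simp add: proj z_def)
      qed
    qed
    moreover have "insert e F \<subseteq> span (E \<union> insert x S)"
      using F(4) mono u by (auto simp: e_def intro: span_scale)
    ultimately show ?thesis using F on by (intro exI[of _ "insert e F"]) auto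
  qed
qed

text \<open>Elements with a null remainder form a subspace, because the cross term of two null
  vectors vanishes.\<close>

lemma complete_for_spanI:
  assumes R: "subspace R" "\<And>x. x \<in> R \<Longrightarrow> 0 \<le> B x x" and "S \<subseteq> R" "E \<subseteq> R"
    and "complete_for E S"
  shows "complete_for E (span S)"
proof -
  define N where "N = {x \<in> R. B (x - proj E x) (x - proj E x) = 0}"
  have pR: "x - proj E x \<in> R" if "x \<in> R" for x
    using that proj_mem[of E x] span_minimal[OF assms(4) R(1)] R(1) by (auto intro: subspace_diff)
  have "subspace N"
    unfolding subspace_def
  proof (intro conjI ballI allI)
    show "0 \<in> N" using R(1) by (simp add: N_def subspace_0 linear_0[OF linear_proj] form_simps)
  next
    fix x y assume xy: "x \<in> N" "y \<in> N"
    define a where "a = x - proj E x"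
    define b where "b = y - proj E y"
    have "x + y - proj E (x + y) = a + b" by (simp add: a_def b_def linear_add[OF linear_proj])
    moreover have "B a a = 0" "B b b = 0" "a \<in> R" "b \<in> R" using xy pR by (auto simp: N_def a_def b_def)
    ultimately have "B (x + y - proj E (x + y)) (x + y - proj E (x + y)) = 0"
      using cauchy_schwarz_null[OF R, of a b] by (simp only: form_simps sym[of b a])
    then show "x + y \<in> N"
      using xy R(1) by (simp add: N_def subspace_add)
  next
    fix c x assume x: "x \<in> N"
    have "c *\<^sub>R x - proj E (c *\<^sub>R x) = c *\<^sub>R (x - proj E x)"
      by (simp add: linear_scale[OF linear_proj] algebra_simps)
    then show "c *\<^sub>R x \<in> N" using x R(1) by (simp add: N_def subspace_scale bilinear_lmul[OF bilinear] bilinear_rmul[OF bilinear])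
  qed
  moreover have "S \<subseteq> N" using assms(3,5) by (auto simp: N_def complete_for_def)
  ultimately have "span S \<subseteq> N" by (rule span_minimal[rotated])
  then show ?thesis by (auto simp: N_def complete_for_def)
qed

text \<open>The null difference \<open>x - w\<close> is orthogonal to \<open>E\<close> and projects
  to zero. This serves to compare the projections for two orthonormal sets with the same
  span.\<close>

lemma proj_eqI:
  assumes R: "subspace R" "\<And>x. x \<in> R \<Longrightarrow> 0 \<le> B x x" and E: "orthonormal E" "finite E" "E \<subseteq> R"
    and x: "x \<in> R" and w: "w \<in> span E" "B (x - w) (x - w) = 0"
  shows "proj E x = w"
proof -
  have "x - w \<in> R" using x w span_minimal[OF E(3) R(1)] R(1) by (auto intro: subspace_diff)
  then have "B e (x - w) = 0" if "e \<in> E" for e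
    using cauchy_schwarz_null[OF R _ w(2), of e] that E sym by auto
  then have "proj E (x - w) = 0" by (simp add: proj_def)
  then show ?thesis using proj_id[OF E(1,2) w(1)] by (simp add: linear_diff[OF linear_proj])
qed

end

section \<open>Polynomials and Riesz functionals\<close>

abbreviation mon :: "nat ^ 'd \<Rightarrow> 'd::finite rpoly" where
  "mon \<alpha> \<equiv> Poly_Mapping.single \<alpha> 1"

abbreviation var :: "'d \<Rightarrow> 'd::finite rpoly" where
  "var i \<equiv> mon (axis i (Suc 0))"

text \<open>Defined as a span so that linear maps can be compared on monomials;
  \<open>mem_polys_le_iff\<close> relates it to \<open>total_degree\<close>.\<close>

definition polys_le :: "nat \<Rightarrow> 'd::finite rpoly set" where
  "polys_le k = span (mon ` multi_indices k)"

lemma finite_multi_indices: "finite (multi_indices k :: (nat ^ 'd::finite) set)"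
proof -
  have "multi_indices k \<subseteq> (\<lambda>f. vec_lambda f :: nat ^ 'd) ` {f. range f \<subseteq> {..k}}"
  proof
    fix \<alpha> :: "nat ^ 'd" assume a: "\<alpha> \<in> multi_indices k"
    have "\<alpha> $ i \<le> mdeg \<alpha>" for i unfolding mdeg_def by (rule member_le_sum) auto
    then have "range (($) \<alpha>) \<subseteq> {..k}" using a by (auto simp: multi_indices_def intro: le_trans)
    then show "\<alpha> \<in> vec_lambda ` {f. range f \<subseteq> {..k}}"
      by (intro image_eqI[of _ _ "($) \<alpha>"]) auto
  qed
  moreover have "finite {f :: 'd \<Rightarrow> nat. range f \<subseteq> {..k}}"
    using finite_set_of_finite_funs[of "UNIV :: 'd set" "{..k}" undefined]
    by (rule finite_subset[rotated]) auto
  ultimately show ?thesis by (meson finite_imageI finite_subset)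
qed

lemma mdeg_add: "mdeg (\<alpha> + \<beta>) = mdeg \<alpha> + mdeg \<beta>"
  by (simp add: mdeg_def sum.distrib)

lemma mdeg_0 [simp]: "mdeg 0 = 0"
  by (simp add: mdeg_def)

lemma mdeg_eq_0_iff: "mdeg \<alpha> = 0 \<longleftrightarrow> \<alpha> = (0 :: nat ^ 'd::finite)"
  by (auto simp: mdeg_def vec_eq_iff)

lemma mdeg_axis [simp]: "mdeg (axis i (Suc 0) :: nat ^ 'd::finite) = 1"
  by (simp add: mdeg_def axis_def)

lemma mdeg_SucE:
  fixes \<alpha> :: "nat ^ 'd::finite"
  assumes "mdeg \<alpha> = Suc k"
  obtains i \<beta> where "\<alpha> = axis i (Suc 0) + \<beta>" "mdeg \<beta> = k"
proof -
  have "(\<Sum>i\<in>UNIV. \<alpha> $ i) \<noteq> 0" using assms by (simp add: mdeg_def)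
  then obtain i where i: "\<alpha> $ i \<noteq> 0" by (meson sum.neutral)
  define \<beta> where "\<beta> = \<alpha> - axis i (Suc 0)"
  have "\<alpha> = axis i (Suc 0) + \<beta>" using i by (auto simp: \<beta>_def vec_eq_iff axis_def)
  moreover from this have "mdeg \<beta> = k" using assms by (simp add: mdeg_add)
  ultimately show ?thesis by (rule that)
qed

text \<open>Unit multi-indices are moved one at a time. The splitting turns a moment into the form
  at two monomials of bounded degrees.\<close>

lemma multi_indices_split:
  fixes \<gamma> :: "nat ^ 'd::finite"
  assumes "\<gamma> \<in> multi_indices (a + b)"
  obtains \<alpha> \<beta> where "\<gamma> = \<alpha> + \<beta>" "\<alpha> \<in> multi_indices a" "\<beta> \<in> multi_indices b"
proof -
  have "\<exists>\<alpha> \<beta>. \<gamma> = \<alpha> + \<beta> \<and> mdeg \<alpha> \<le> a \<and> mdeg \<beta> \<le> b" if "mdeg \<gamma> \<le> a + b" for \<gamma> :: "nat ^ 'd"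
    using that
  proof (induction a arbitrary: \<gamma>)
    case 0
    then show ?case by (intro exI[of _ 0] exI[of _ \<gamma>]) auto
  next
    case (Suc a)
    show ?case
    proof (cases "mdeg \<gamma>")
      case 0
      then show ?thesis by (intro exI[of _ 0] exI[of _ \<gamma>]) auto
    next
      case (Suc k)
      then obtain i \<delta> where d: "\<gamma> = axis i (Suc 0) + \<delta>" "mdeg \<delta> = k" by (rule mdeg_SucE)
      then obtain \<alpha> \<beta> where "\<delta> = \<alpha> + \<beta>" "mdeg \<alpha> \<le> a" "mdeg \<beta> \<le> b"
        using Suc.IH[of \<delta>] Suc.prems Suc by auto
      then show ?thesis using d
        by (intro exI[of _ \<beta>] exI[of _ "axis i (Suc 0) + \<alpha>"]) (auto simp: mdeg_add add.assoc)
    qed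
  qed
  with assms that show ?thesis by (fastforce simp: multi_indices_def)
qed

lemma monomial_eval_add: "monomial_eval (\<alpha> + \<beta>) x = monomial_eval \<alpha> x * monomial_eval \<beta> x"
  by (simp add: monomial_eval_def power_add prod.distrib)

lemma monomial_eval_0 [simp]: "monomial_eval 0 x = 1"
  by (simp add: monomial_eval_def)

lemma monomial_eval_axis: "monomial_eval (axis i (Suc 0)) x = x $ (i :: 'd::finite)"
proof -
  have "monomial_eval (axis i (Suc 0)) x = (\<Prod>j\<in>UNIV. if j = i then x $ j else 1)"
    unfolding monomial_eval_def by (intro prod.cong) (auto simp: axis_def)
  then show ?thesis by simp
qed

lemma lookup_scaleR: "Poly_Mapping.lookup (c *\<^sub>R p) \<alpha> = c *\<^sub>R Poly_Mapping.lookup p \<alpha>"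
proof -
  have "finite {\<alpha>. c *\<^sub>R Poly_Mapping.lookup p \<alpha> \<noteq> 0}"
    by (rule finite_subset[OF _ finite_lookup[of p]]) auto
  then show ?thesis by (simp add: scaleR_poly_mapping_def)
qed

lemma single_eq_scaleR: "Poly_Mapping.single \<alpha> c = c *\<^sub>R mon \<alpha>"
  by (intro poly_mapping_eqI) (simp add: lookup_scaleR lookup_single when_def)

lemma poly_eq_sum_mon:
  assumes "finite A" "Poly_Mapping.keys p \<subseteq> A"
  shows "p = (\<Sum>\<alpha>\<in>A. Poly_Mapping.lookup p \<alpha> *\<^sub>R mon \<alpha>)"
proof (intro poly_mapping_eqI)
  fix \<alpha>
  have "Poly_Mapping.lookup (\<Sum>\<alpha>\<in>A. Poly_Mapping.lookup p \<alpha> *\<^sub>R mon \<alpha>) \<alpha> =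
      (\<Sum>\<beta>\<in>A. if \<beta> = \<alpha> then Poly_Mapping.lookup p \<beta> else 0)"
    unfolding lookup_sum lookup_scaleR by (intro sum.cong) (auto simp: lookup_single when_def)
  also have "\<dots> = Poly_Mapping.lookup p \<alpha>"
    using assms by (auto simp: in_keys_iff)
  finally show "Poly_Mapping.lookup p \<alpha> =
      Poly_Mapping.lookup (\<Sum>\<alpha>\<in>A. Poly_Mapping.lookup p \<alpha> *\<^sub>R mon \<alpha>) \<alpha>" by simp
qed

text \<open>Compatibility of scalars with products thereby reduces to commutativity and
  associativity of the ring.\<close>

lemma scaleR_eq_mult: "c *\<^sub>R p = Poly_Mapping.single 0 c * (p :: 'd::finite rpoly)"
proof -
  define q where "q \<alpha> = Poly_Mapping.single \<alpha> (Poly_Mapping.lookup p \<alpha>)" for \<alpha>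
  have p: "p = (\<Sum>\<alpha>\<in>Poly_Mapping.keys p. q \<alpha>)"
    unfolding q_def single_eq_scaleR[of _ "Poly_Mapping.lookup p _"]
    by (rule poly_eq_sum_mon) auto
  have q: "Poly_Mapping.single 0 c * q \<alpha> = c *\<^sub>R q \<alpha>" for \<alpha>
    by (intro poly_mapping_eqI)
      (simp add: q_def mult_single lookup_scaleR lookup_single when_def)
  have "Poly_Mapping.single 0 c * (\<Sum>\<alpha>\<in>Poly_Mapping.keys p. q \<alpha>) = c *\<^sub>R (\<Sum>\<alpha>\<in>Poly_Mapping.keys p. q \<alpha>)"
    by (simp add: sum_distrib_left q scaleR_sum_right)
  then show ?thesis using p by simp
qed

lemma mult_scaleR_right: "p * (c *\<^sub>R q) = c *\<^sub>R (p * q)" for p q :: "'d::finite rpoly"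
  by (simp add: scaleR_eq_mult mult_ac)

lemma mult_scaleR_left: "(c *\<^sub>R p) * q = c *\<^sub>R (p * q)" for p q :: "'d::finite rpoly"
  by (simp add: scaleR_eq_mult mult_ac)

lemma linear_mult: "linear ((*) p)" for p :: "'d::finite rpoly"
  by (intro linearI) (simp_all add: distrib_left mult_scaleR_right)

lemma mon_mult: "mon \<alpha> * mon \<beta> = mon (\<alpha> + \<beta>)"
  by (simp add: mult_single)

section \<open>The Riesz functional and evaluation\<close>

lemma riesz_eq_sum:
  assumes "finite A" "Poly_Mapping.keys p \<subseteq> A"
  shows "riesz \<phi> p = (\<Sum>\<alpha>\<in>A. Poly_Mapping.lookup p \<alpha> * \<phi> \<alpha>)"
  unfolding riesz_def using assms by (intro sum.mono_neutral_left) (auto simp: in_keys_iff)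

lemma linear_riesz: "linear (riesz \<phi>)" for \<phi> :: "nat ^ 'd::finite \<Rightarrow> real"
proof (intro linearI)
  fix p q :: "'d rpoly" and c :: real
  define A where "A = Poly_Mapping.keys p \<union> Poly_Mapping.keys q"
  have A: "finite A" "Poly_Mapping.keys p \<subseteq> A" "Poly_Mapping.keys q \<subseteq> A"
    "Poly_Mapping.keys (p + q) \<subseteq> A" "Poly_Mapping.keys (c *\<^sub>R p) \<subseteq> A"
    using keys_add[of p q] by (auto simp: A_def in_keys_iff lookup_scaleR)
  show "riesz \<phi> (p + q) = riesz \<phi> p + riesz \<phi> q"
    using A by (simp add: riesz_eq_sum[of A] lookup_add distrib_right sum.distrib)
  show "riesz \<phi> (c *\<^sub>R p) = c *\<^sub>R riesz \<phi> p"
    using A by (simp add: riesz_eq_sum[of A] lookup_scaleR sum_distrib_left mult.assoc)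
qed

lemma riesz_mon [simp]: "riesz \<phi> (mon \<alpha>) = \<phi> \<alpha>"
  by (simp add: riesz_def)

lemma riesz_one [simp]: "riesz \<phi> 1 = \<phi> 0"
  by (simp flip: single_one)

text \<open>Evaluation is the Riesz functional of a Dirac measure, from which it inherits
  linearity.\<close>

lemma poly_eval_eq_riesz: "poly_eval p x = riesz (\<lambda>\<alpha>. monomial_eval \<alpha> x) p"
  by (simp add: poly_eval_def riesz_def)

lemma linear_poly_eval: "linear (\<lambda>p. poly_eval p x)"
  unfolding poly_eval_eq_riesz by (rule linear_riesz)

lemma poly_eval_mon [simp]: "poly_eval (mon \<alpha>) x = monomial_eval \<alpha> x"
  by (simp add: poly_eval_eq_riesz)

lemma span_mon: "p \<in> span (range mon)"
proof -
  have "p = (\<Sum>\<alpha>\<in>Poly_Mapping.keys p. Poly_Mapping.lookup p \<alpha> *\<^sub>R mon \<alpha>)"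
    by (rule poly_eq_sum_mon) auto
  also have "\<dots> \<in> span (range mon)" by (intro span_sum span_scale span_base) auto
  finally show ?thesis .
qed

lemma poly_eval_mult: "poly_eval (p * q) x = poly_eval p x * poly_eval q x"
proof -
  have mon: "poly_eval (mon \<alpha> * q) x = monomial_eval \<alpha> x * poly_eval q x" for \<alpha>
  proof (rule linear_eq_on_span[OF _ _ _ span_mon, of "\<lambda>q. poly_eval (mon \<alpha> * q) x"])
    show "linear (\<lambda>q. poly_eval (mon \<alpha> * q) x)"
      using linear_compose[OF linear_mult linear_poly_eval] by (simp add: o_def)
    show "linear (\<lambda>q. monomial_eval \<alpha> x * poly_eval q x)"
      by (intro linearI) (simp_all add: linear_add[OF linear_poly_eval]
          linear_scale[OF linear_poly_eval] algebra_simps)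
  qed (auto simp: mon_mult monomial_eval_add)
  show ?thesis
  proof (rule linear_eq_on_span[OF _ _ _ span_mon, of "\<lambda>p. poly_eval (p * q) x"])
    show "linear (\<lambda>p. poly_eval (p * q) x)"
      using linear_compose[OF linear_mult linear_poly_eval] by (simp add: o_def mult.commute[of _ q])
    show "linear (\<lambda>p. poly_eval p x * poly_eval q x)"
      by (intro linearI) (simp_all add: linear_add[OF linear_poly_eval]
          linear_scale[OF linear_poly_eval] algebra_simps)
  qed (auto simp: mon)
qed

lemma localizing_matrix_eq_riesz: "localizing_matrix g \<phi> \<alpha> \<beta> = riesz \<phi> (mon \<alpha> * mon \<beta> * g)"
proof -
  have "riesz \<phi> (mon \<alpha> * mon \<beta> * g) =
      riesz \<phi> (mon (\<alpha> + \<beta>) * (\<Sum>\<gamma>\<in>Poly_Mapping.keys g. Poly_Mapping.lookup g \<gamma> *\<^sub>R mon \<gamma>))"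
    using poly_eq_sum_mon[of "Poly_Mapping.keys g" g] by (simp add: mon_mult)
  also have "\<dots> = localizing_matrix g \<phi> \<alpha> \<beta>"
    by (simp add: sum_distrib_left mult_scaleR_right linear_sum[OF linear_riesz]
        linear_scale[OF linear_riesz] mon_mult localizing_matrix_def)
  finally show ?thesis by simp
qed

lemma polys_le_sum:
  assumes "p \<in> polys_le k"
  obtains c where "p = (\<Sum>\<alpha>\<in>multi_indices k. c \<alpha> *\<^sub>R mon \<alpha>)"
proof -
  have inj: "inj_on mon (multi_indices k)" 
    by (intro inj_onI) (metis lookup_single_eq lookup_single_not_eq zero_neq_one)
  obtain u where "p = (\<Sum>v\<in>mon ` multi_indices k. u v *\<^sub>R v)"
    using assms by (auto simp: polys_le_def span_finite finite_multi_indices)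
  then have "p = (\<Sum>\<alpha>\<in>multi_indices k. u (mon \<alpha>) *\<^sub>R mon \<alpha>)"
    by (simp add: sum.reindex[OF inj])
  then show ?thesis by (rule that)
qed

lemma riesz_square_mult:
  fixes g :: "'d::finite rpoly"
  shows "riesz \<phi> ((\<Sum>\<alpha>\<in>A. c \<alpha> *\<^sub>R mon \<alpha>) * (\<Sum>\<alpha>\<in>A. c \<alpha> *\<^sub>R mon \<alpha>) * g) =
    (\<Sum>\<alpha>\<in>A. \<Sum>\<beta>\<in>A. c \<alpha> * localizing_matrix g \<phi> \<alpha> \<beta> * c \<beta>)"
proof -
  have "(\<Sum>\<alpha>\<in>A. c \<alpha> *\<^sub>R mon \<alpha>) * (\<Sum>\<alpha>\<in>A. c \<alpha> *\<^sub>R mon \<alpha>) * g =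
      (\<Sum>\<alpha>\<in>A. \<Sum>\<beta>\<in>A. (c \<alpha> * c \<beta>) *\<^sub>R (mon \<alpha> * mon \<beta> * g))"
    unfolding sum_product
    by (simp only: sum_distrib_right mult_scaleR_left mult_scaleR_right scaleR_scaleR
        mult.commute[of "c _" "c _"])
  then show ?thesis
    by (simp only: linear_sum[OF linear_riesz] linear_scale[OF linear_riesz]
        localizing_matrix_eq_riesz) (simp add: mult_ac)
qed

text \<open>The value is the quadratic form of the localizing matrix at the coefficient vector of
  \<open>p\<close>.\<close>

lemma psd_localizing_nonneg:
  assumes "psd_on (multi_indices k) (localizing_matrix g \<phi>)" "p \<in> polys_le k"
  shows "0 \<le> riesz \<phi> (p * p * g)"
proof -
  obtain c where p: "p = (\<Sum>\<alpha>\<in>multi_indices k. c \<alpha> *\<^sub>R mon \<alpha>)"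
    using assms(2) by (rule polys_le_sum)
  show ?thesis unfolding p riesz_square_mult using assms(1) by (simp add: psd_on_def)
qed

lemma subspace_polys_le: "subspace (polys_le k)"
  by (simp add: polys_le_def)

lemma mon_mem_polys_le: "\<alpha> \<in> multi_indices k \<Longrightarrow> mon \<alpha> \<in> polys_le k"
  by (auto simp: polys_le_def intro: span_base)

lemma polys_le_mono: "k \<le> l \<Longrightarrow> polys_le k \<subseteq> polys_le l"
  unfolding polys_le_def by (intro span_mono image_mono) (auto simp: multi_indices_def)

lemma var_mult_mem:
  assumes "p \<in> polys_le k" "Suc k \<le> l"
  shows "var i * p \<in> polys_le l"
proof -
  have "(*) (var i) ` polys_le k = span ((*) (var i) ` mon ` multi_indices k)"
    unfolding polys_le_def by (rule linear_span_image[OF linear_mult, symmetric])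
  also have "\<dots> \<subseteq> polys_le l"
    using assms(2) unfolding polys_le_def
    by (intro span_mono) (auto simp: mon_mult multi_indices_def mdeg_add)
  finally show ?thesis using assms(1) by auto
qed

lemma mem_polys_le_iff: "p \<in> polys_le k \<longleftrightarrow> total_degree p \<le> k"
proof
  assume "total_degree p \<le> k"
  then have "Poly_Mapping.keys p \<subseteq> multi_indices k"
    by (auto simp: total_degree_def multi_indices_def)
  then have "p = (\<Sum>\<alpha>\<in>multi_indices k. Poly_Mapping.lookup p \<alpha> *\<^sub>R mon \<alpha>)"
    by (intro poly_eq_sum_mon finite_multi_indices)
  also have "\<dots> \<in> polys_le k"
    unfolding polys_le_def by (intro span_sum span_scale span_base) auto
  finally show "p \<in> polys_le k" .
next
  assume "p \<in> polys_le k"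
  then obtain c where p: "p = (\<Sum>\<alpha>\<in>multi_indices k. c \<alpha> *\<^sub>R mon \<alpha>)" by (rule polys_le_sum)
  have "\<beta> \<in> multi_indices k" if "\<beta> \<in> Poly_Mapping.keys p" for \<beta>
  proof (rule ccontr)
    assume "\<beta> \<notin> multi_indices k"
    then have "Poly_Mapping.lookup p \<beta> = 0"
      unfolding p lookup_sum lookup_scaleR by (intro sum.neutral) (auto simp: lookup_single when_def)
    with that show False by (simp add: in_keys_iff)
  qed
  then show "total_degree p \<le> k" by (auto simp: total_degree_def multi_indices_def)
qed

section \<open>Probability measures with finite support\<close>

lemma ex_pmf_finite:
  assumes "finite A" "\<And>x. x \<in> A \<Longrightarrow> 0 < w x" "sum w A = (1::real)"
  obtains \<mu> where "set_pmf \<mu> = A" "\<And>x. x \<in> A \<Longrightarrow> pmf \<mu> x = w x"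
proof -
  define W where "W x = (if x \<in> A then w x else 0)" for x
  have nn: "0 \<le> W x" for x using assms(2)[of x] by (auto simp: W_def)
  have "(\<integral>\<^sup>+x. ennreal (W x) \<partial>count_space UNIV) = (\<Sum>x\<in>A. ennreal (W x))"
    using assms(1) by (intro nn_integral_count_space'[where A = A]) (auto simp: W_def)
  also have "\<dots> = ennreal (\<Sum>x\<in>A. W x)"
    using nn by (simp add: sum_ennreal)
  also have "(\<Sum>x\<in>A. W x) = 1"
    using assms(3) by (simp add: W_def)
  also have "ennreal 1 = 1" by simp
  finally have pm: "pmf (embed_pmf W) x = W x" for x using nn by (intro pmf_embed_pmf)
  show ?thesis
  proof (rule that)
    show "set_pmf (embed_pmf W) = A"
      using assms(2) by (force simp: set_pmf_eq pm W_def)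
    show "pmf (embed_pmf W) x = w x" if "x \<in> A" for x using that by (simp add: pm W_def)
  qed
qed

section \<open>Ranks of moment matrices\<close>

text \<open>The moment matrix appears as \<open>localizing_matrix 1\<close>, the shape it has as the
  constraint of index 0 in the relaxation. The normalization \<open>\<phi> 0 = 1\<close> is assumed
  separately where it matters.\<close>

locale truncated_moments =
  fixes \<phi> :: "nat ^ 'd::finite \<Rightarrow> real" and n :: nat
  assumes psd: "psd_on (multi_indices n) (localizing_matrix 1 \<phi>)"
begin

definition form :: "'d rpoly \<Rightarrow> 'd rpoly \<Rightarrow> real" where
  "form p q = riesz \<phi> (p * q)"

sublocale symmetric_form form
proof
  show "form p q = form q p" for p q by (simp add: form_def mult.commute)
  show "bilinear form"
    unfolding bilinear_def form_def
    using linear_compose[OF linear_mult linear_riesz]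
    by (auto simp: o_def mult.commute[of _ y for y])
qed

lemma form_mon [simp]: "form (mon \<alpha>) (mon \<beta>) = \<phi> (\<alpha> + \<beta>)"
  by (simp add: form_def mon_mult)

lemma form_nonneg: "p \<in> polys_le n \<Longrightarrow> 0 \<le> form p p"
  using psd_localizing_nonneg[OF psd] by (simp add: form_def)

lemma form_null: "p \<in> polys_le n \<Longrightarrow> form p p = 0 \<Longrightarrow> q \<in> polys_le n \<Longrightarrow> form p q = 0"
  using cauchy_schwarz_null[OF subspace_polys_le form_nonneg] by blast

lemma form_var_shift: "form (var i * p) q = form p (var i * q)"
  by (simp add: form_def mult_ac)

text \<open>An orthonormal basis of the polynomials of degree at most \<open>k\<close> modulo the
  kernel of the form.\<close>

definition basis :: "nat \<Rightarrow> 'd rpoly set \<Rightarrow> bool" where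
  "basis k E \<longleftrightarrow> finite E \<and> orthonormal E \<and> E \<subseteq> polys_le k \<and> complete_for E (polys_le k)"

lemma basis_extend:
  assumes "finite E" "orthonormal E" "E \<subseteq> polys_le k" "k \<le> n"
  shows "\<exists>F. basis k F \<and> E \<subseteq> F"
proof -
  have le: "polys_le k \<subseteq> polys_le n" by (rule polys_le_mono[OF assms(4)])
  have nn: "\<And>x. x \<in> polys_le k \<Longrightarrow> 0 \<le> form x x" using le form_nonneg by blast
  have S: "finite (mon ` multi_indices k :: 'd rpoly set)" "mon ` multi_indices k \<subseteq> polys_le k"
    by (auto simp: finite_multi_indices polys_le_def span_base)
  obtain F where F: "finite F" "E \<subseteq> F" "orthonormal F"
    "F \<subseteq> span (E \<union> mon ` multi_indices k)" "complete_for F (mon ` multi_indices k)"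
    using gram_schmidt[OF subspace_polys_le nn S assms(1,3,2)] by blast
  have "span (E \<union> mon ` multi_indices k) \<subseteq> polys_le k"
    using S assms(3) by (intro span_minimal subspace_polys_le) auto
  with F(4) have Fk: "F \<subseteq> polys_le k" by blast
  have "complete_for F (span (mon ` multi_indices k))"
    by (rule complete_for_spanI[OF subspace_polys_le nn S(2) Fk F(5)])
  then have "complete_for F (polys_le k)" by (simp add: polys_le_def)
  with F Fk show ?thesis unfolding basis_def by blast
qed

lemma basis_ex: "k \<le> n \<Longrightarrow> \<exists>E. basis k E"
  using basis_extend[of "{}" k] by (auto simp: orthonormal_def)

lemma basis_chain:
  assumes "basis k E" "k \<le> l" "l \<le> n"
  shows "\<exists>F. basis l F \<and> E \<subseteq> F"
  using assms basis_extend[of E l] polys_le_mono[of k l] by (auto simp: basis_def)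

lemma span_basis: "basis k E \<Longrightarrow> span E \<subseteq> polys_le k"
  unfolding basis_def by (intro span_minimal subspace_polys_le) auto

text \<open>The remainder of \<open>x\<close> is null, hence orthogonal to all polynomials of degree
  at most \<open>n\<close>.\<close>

lemma form_proj:
  assumes "basis k E" "k \<le> n" "x \<in> polys_le k" "y \<in> polys_le n"
  shows "form (proj E x) y = form x y"
proof -
  have "x - proj E x \<in> polys_le k"
    using assms(3) proj_mem[of E x] span_basis[OF assms(1)]
    by (auto intro: subspace_diff[OF subspace_polys_le])
  then have "x - proj E x \<in> polys_le n" using polys_le_mono[OF assms(2)] by blast
  moreover have "form (x - proj E x) (x - proj E x) = 0"
    using assms by (auto simp: basis_def complete_for_def)
  ultimately show ?thesis using form_null[of "x - proj E x" y] assms(4) by (simp add: bilinear_lsub[OF bilinear])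
qed

lemma parseval:
  assumes "basis k E" "k \<le> n" "x \<in> polys_le k" "y \<in> polys_le n"
  shows "form x y = (\<Sum>e\<in>E. form e x * form e y)"
  by (subst form_proj[OF assms, symmetric]) (simp add: proj_def sum_left form_simps)

text \<open>Here \<open>x\<close> may exceed degree \<open>k\<close>, so its remainder need not be
  null. It is still orthogonal to \<open>span E\<close>, and \<open>y\<close> can be replaced by its
  projection there.\<close>

lemma form_proj_low:
  assumes E: "basis k E" and k: "k \<le> n" and x: "x \<in> polys_le n" and y: "y \<in> polys_le k"
  shows "form (proj E x) y = form x y"
proof -
  have pE: "proj E x \<in> polys_le n"
    using proj_mem[of E x] span_basis[OF E] polys_le_mono[OF k] by blast
  have "form (proj E x) y = form (proj E y) (proj E x)"
    unfolding form_proj[OF E k y pE] by (rule sym)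
  also have "\<dots> = form (proj E x) (proj E y)" by (rule sym)
  also have "\<dots> = form x (proj E y)"
    using proj_orth[of E "proj E y" x] E proj_mem[of E y]
    by (simp add: basis_def form_simps)
  also have "\<dots> = form (proj E y) x" by (rule sym)
  also have "\<dots> = form y x" by (rule form_proj[OF E k y x])
  also have "\<dots> = form x y" by (rule sym)
  finally show ?thesis .
qed

text \<open>The column space is the image of \<open>polys_le k\<close> under
  \<open>p \<mapsto> (form (mon \<alpha>) p)\<close>. Projecting to \<open>span E\<close> keeps this
  image, and on \<open>span E\<close> the map is injective because the form is definite.\<close>

lemma moment_rank_eq_card:
  assumes E: "basis k E" and k: "k \<le> n"
  shows "moment_rank k \<phi> = card E"
proof -
  define col where "col p = (\<Sum>\<alpha>\<in>multi_indices k. Poly_Mapping.single \<alpha> (form (mon \<alpha>) p))" for p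
  have lookup: "Poly_Mapping.lookup (col p) \<alpha> = form (mon \<alpha>) p" if "\<alpha> \<in> multi_indices k" for p \<alpha>
    using that by (simp add: col_def lookup_sum lookup_single when_def finite_multi_indices)
  have lin: "linear col"
  proof (intro linearI poly_mapping_eqI)
    have out: "Poly_Mapping.lookup (col p) \<alpha> = 0" if "\<alpha> \<notin> multi_indices k" for p \<alpha>
      using that unfolding col_def lookup_sum
      by (intro sum.neutral) (auto simp: lookup_single when_def)
    fix p q \<alpha> and c :: real
    show "Poly_Mapping.lookup (col (p + q)) \<alpha> = Poly_Mapping.lookup (col p + col q) \<alpha>"
      by (cases "\<alpha> \<in> multi_indices k") (simp_all add: lookup out lookup_add form_simps)
    show "Poly_Mapping.lookup (col (c *\<^sub>R p)) \<alpha> = Poly_Mapping.lookup (c *\<^sub>R col p) \<alpha>"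
      by (cases "\<alpha> \<in> multi_indices k") (simp_all add: lookup out lookup_scaleR form_simps)
  qed
  have mem: "mon \<alpha> \<in> polys_le n" if "\<alpha> \<in> multi_indices k" for \<alpha> :: "nat ^ 'd"
    using mon_mem_polys_le[OF that] polys_le_mono[OF k] by blast
  have "moment_rank k \<phi> = dim (col ` mon ` multi_indices k)"
    by (simp add: moment_rank_def rank_on_def moment_matrix_def col_def image_image)
  also have "\<dots> = dim (span (col ` mon ` multi_indices k))" by simp
  also have "span (col ` mon ` multi_indices k) = col ` polys_le k"
    unfolding polys_le_def by (rule linear_span_image[OF lin])
  also have "col ` polys_le k = col ` span E"
  proof
    show "col ` span E \<subseteq> col ` polys_le k" using span_basis[OF E] by blast
    have "col p = col (proj E p)" if "p \<in> polys_le k" for p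
      unfolding col_def using form_proj[OF E k that mem] sym by (intro sum.cong) metis+
    then show "col ` polys_le k \<subseteq> col ` span E" using proj_mem by blast
  qed
  also have "col ` span E = span (col ` E)" by (rule linear_span_image[OF lin, symmetric])
  also have "dim (span (col ` E)) = card (col ` E)"
  proof -
    have EE: "orthonormal E" "finite E" using E by (auto simp: basis_def)
    have inj: "inj_on col (span E)"
      unfolding linear_inj_on_iff_eq_0[OF lin subspace_span]
    proof safe
      fix x assume x: "x \<in> span E" "col x = 0"
      have "form x y = 0" if "y \<in> polys_le k" for y
        using that unfolding polys_le_def
      proof (rule null_on_span[rotated])
        show "form x y = 0" if "y \<in> mon ` multi_indices k" for y
          using that lookup[of _ x] x(2) sym[of x y] by auto
      qed
      then have "form x x = 0" using x span_basis[OF E] by blast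
      then show "x = 0" using orthonormal_pos[OF EE x(1)] by force
    qed
    have "independent (col ` E)"
      by (rule linear_independent_injective_image[OF lin orthonormal_independent[OF EE] inj])
    then show ?thesis by (rule dim_span_eq_card_independent)
  qed
  also have "card (col ` E) = card E"
  proof (rule card_image)
    have EE: "orthonormal E" "finite E" using E by (auto simp: basis_def)
    show "inj_on col E"
    proof (rule inj_onI, rule ccontr)
      fix x y assume xy: "x \<in> E" "y \<in> E" "col x = col y" "x \<noteq> y"
      have mon: "form x (mon \<alpha>) = form y (mon \<alpha>)" if "\<alpha> \<in> multi_indices k" for \<alpha>
        using lookup[OF that, of x] lookup[OF that, of y] xy(3)
          sym[of x "mon \<alpha>"] sym[of y "mon \<alpha>"] by simp
      have "form x z = form y z" if "z \<in> polys_le k" for z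
      proof (rule linear_eq_on_span[OF linear_right linear_right _ that[unfolded polys_le_def]])
        show "form x p = form y p" if "p \<in> mon ` multi_indices k" for p
          using that mon by blast
      qed
      then have "form x x = form y x" using xy E by (auto simp: basis_def)
      then show False using xy EE by (auto simp: orthonormal_def)
    qed
  qed
  finally show ?thesis .
qed

lemma moment_rank_mono:
  assumes "k \<le> l" "l \<le> n"
  shows "moment_rank k \<phi> \<le> moment_rank l \<phi>"
proof -
  obtain E where "basis k E" using basis_ex[of k] assms by auto
  moreover obtain F where "basis l F" "E \<subseteq> F" using basis_chain[OF calculation assms] by blast
  ultimately show ?thesis
    using moment_rank_eq_card[of k E] moment_rank_eq_card[of l F] assms
    by (simp add: basis_def card_mono)
qed

lemma basis_if_rank_eq:
  assumes E: "basis k E" and "k \<le> l" "l \<le> n" and "moment_rank k \<phi> = moment_rank l \<phi>"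
  shows "basis l E"
proof -
  obtain F where F: "basis l F" "E \<subseteq> F" using basis_chain[OF E assms(2,3)] by blast
  then have "card F = card E" using assms moment_rank_eq_card[of k E] moment_rank_eq_card[of l F] by simp
  then have "E = F" using F card_subset_eq[of F E] by (simp add: basis_def)
  with F show ?thesis by simp
qed

text \<open>A monomial of degree \<open>k + 2\<close> is a variable times one of degree
  \<open>k + 1\<close>, and the latter is congruent modulo null vectors to a polynomial of degree at
  most \<open>k\<close>.\<close>

lemma moment_rank_propagate_Suc:
  assumes k: "Suc (Suc k) < n" and eq: "moment_rank k \<phi> = moment_rank (Suc k) \<phi>"
  shows "moment_rank (Suc (Suc k)) \<phi> = moment_rank (Suc k) \<phi>"
proof -
  obtain E where E0: "basis k E" using basis_ex[of k] k by auto
  then have E: "basis (Suc k) E" using basis_if_rank_eq[OF E0] k eq by simp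
  have on: "orthonormal E" "finite E" using E by (auto simp: basis_def)
  have En: "E \<subseteq> polys_le n" using E polys_le_mono[of "Suc k" n] k by (auto simp: basis_def)
  have "complete_for E (mon ` multi_indices (Suc (Suc k)))"
    unfolding complete_for_def
  proof safe
    fix \<alpha> :: "nat ^ 'd" assume a: "\<alpha> \<in> multi_indices (Suc (Suc k))"
    show "form (mon \<alpha> - proj E (mon \<alpha>)) (mon \<alpha> - proj E (mon \<alpha>)) = 0"
    proof (cases "mdeg \<alpha> = Suc (Suc k)")
      case False
      then have "mon \<alpha> \<in> polys_le (Suc k)" using a by (intro mon_mem_polys_le) (auto simp: multi_indices_def)
      then show ?thesis using E by (auto simp: basis_def complete_for_def)
    next
      case True
      then obtain i \<beta> where b: "\<alpha> = axis i (Suc 0) + \<beta>" "mdeg \<beta> = Suc k" by (rule mdeg_SucE)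
      define w where "w = proj E (mon \<beta>)"
      have bk: "mon \<beta> \<in> polys_le (Suc k)" using b by (intro mon_mem_polys_le) (auto simp: multi_indices_def)
      have wk: "w \<in> polys_le k" unfolding w_def using proj_mem span_basis[OF E0] by blast
      define u where "u = var i * (mon \<beta> - w)"
      have "mon \<beta> - w \<in> polys_le (Suc k)"
        using bk wk polys_le_mono[of k "Suc k"] by (auto intro: subspace_diff[OF subspace_polys_le])
      then have u: "u \<in> polys_le (Suc (Suc k))" unfolding u_def by (rule var_mult_mem) simp
      \<comment> \<open>Shifting the variable pairs a null remainder with a polynomial of degree at
        most \<open>k + 3\<close>, which is at most \<open>n\<close> by assumption.\<close>
      have "form u u = form (mon \<beta> - w) (var i * u)" by (subst (1) u_def) (rule form_var_shift)
      also have "\<dots> = 0"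
        using form_proj[OF E _ bk, of "var i * u"] var_mult_mem[OF u, of n i] k
        by (simp add: w_def form_simps)
      finally have uu: "form u u = 0" .
      have "var i * w \<in> polys_le (Suc k)" using wk by (rule var_mult_mem) simp
      then have pw: "form (var i * w - proj E (var i * w)) (var i * w - proj E (var i * w)) = 0"
        and vw: "var i * w \<in> polys_le n"
        using E polys_le_mono[of "Suc k" n] k by (auto simp: basis_def complete_for_def)
      have un: "u \<in> polys_le n" using u polys_le_mono[of "Suc (Suc k)" n] k by auto
      have "form e u = 0" if "e \<in> E" for e
        using form_null[OF un uu, of e] that En sym by auto
      then have "proj E u = 0" by (simp add: proj_def)
      moreover have eq: "mon \<alpha> = u + var i * w" by (simp add: u_def b mon_mult algebra_simps)
      ultimately have "mon \<alpha> - proj E (mon \<alpha>) = u + (var i * w - proj E (var i * w))"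
        by (simp add: linear_add[OF linear_proj])
      moreover have "form u (var i * w - proj E (var i * w)) = 0"
        using proj_mem[of E "var i * w"] span_minimal[OF En subspace_polys_le] vw
        by (intro form_null[OF un uu] subspace_diff[OF subspace_polys_le]) auto
      ultimately show ?thesis using uu pw
        by (simp only: bilinear_ladd[OF bilinear] bilinear_radd[OF bilinear]
            sym[of "var i * w - proj E (var i * w)" u])
    qed
  qed
  then have "complete_for E (polys_le (Suc (Suc k)))"
    unfolding polys_le_def[of "Suc (Suc k)"]
    using k En polys_le_mono[of "Suc (Suc k)" n]
    by (intro complete_for_spanI[OF subspace_polys_le form_nonneg]) (auto simp: mon_mem_polys_le)
  then have "basis (Suc (Suc k)) E"
    using E polys_le_mono[of "Suc k" "Suc (Suc k)"] by (auto simp: basis_def)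
  then show ?thesis
    using moment_rank_eq_card[OF E] moment_rank_eq_card[of "Suc (Suc k)" E] k by simp
qed

text \<open>The conclusion stops at order \<open>n - 1\<close>, because each step multiplies by one
  further variable within degree \<open>n\<close>.\<close>

lemma moment_rank_propagate:
  assumes "moment_rank k \<phi> = moment_rank (Suc k) \<phi>" "Suc k \<le> l" "l < n"
  shows "moment_rank l \<phi> = moment_rank k \<phi>"
proof -
  have "moment_rank (Suc k + j) \<phi> = moment_rank k \<phi> \<and> moment_rank (k + j) \<phi> = moment_rank k \<phi>"
    if "Suc k + j < n" for j
    using that
  proof (induction j)
    case (Suc j)
    then show ?case using moment_rank_propagate_Suc[of "k + j"] by simp
  qed (simp add: assms)
  from this[of "l - Suc k"] assms show ?thesis by simp
qed

end

section \<open>Atomic measures\<close>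

lemma polys_le_mult:
  assumes "p \<in> polys_le a" "q \<in> polys_le b"
  shows "p * q \<in> polys_le (a + b)"
proof -
  have mon: "mon \<alpha> * q \<in> polys_le (a + b)" if "\<alpha> \<in> multi_indices a" for \<alpha> :: "nat ^ 'a"
  proof -
    have "(*) (mon \<alpha>) ` polys_le b = span ((*) (mon \<alpha>) ` mon ` multi_indices b)"
      unfolding polys_le_def by (rule linear_span_image[OF linear_mult, symmetric])
    also have "\<dots> \<subseteq> polys_le (a + b)"
      using that unfolding polys_le_def
      by (intro span_mono) (auto simp: mon_mult multi_indices_def mdeg_add)
    finally show ?thesis using assms(2) by auto
  qed
  have "(*) q ` polys_le a = span ((*) q ` mon ` multi_indices a)"
    unfolding polys_le_def by (rule linear_span_image[OF linear_mult, symmetric])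
  also have "\<dots> \<subseteq> polys_le (a + b)"
    using mon by (intro span_minimal subspace_polys_le) (auto simp: mult.commute[of q])
  finally show ?thesis using assms(1) by (auto simp: mult.commute[of p])
qed

text \<open>In contrast to \<open>atomic_representing\<close>, the degree may be odd and the number
  of atoms is free.\<close>

definition represents :: "nat \<Rightarrow> (nat ^ 'd::finite \<Rightarrow> real) \<Rightarrow> (real ^ 'd) pmf \<Rightarrow> bool" where
  "represents N \<phi> \<mu> \<longleftrightarrow> finite (set_pmf \<mu>) \<and>
     (\<forall>\<alpha>\<in>multi_indices N. \<phi> \<alpha> = measure_pmf.expectation \<mu> (monomial_eval \<alpha>))"

lemma represents_mono: "represents N \<phi> \<mu> \<Longrightarrow> M \<le> N \<Longrightarrow> represents M \<phi> \<mu>"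
  by (auto simp: represents_def multi_indices_def)

lemma represents_riesz:
  fixes \<phi> :: "nat ^ 'd::finite \<Rightarrow> real"
  assumes "represents N \<phi> \<mu>" "p \<in> polys_le N"
  shows "riesz \<phi> p = (\<Sum>x\<in>set_pmf \<mu>. pmf \<mu> x * poly_eval p x)"
proof (rule linear_eq_on_span[OF linear_riesz _ _ assms(2)[unfolded polys_le_def]])
  show "linear (\<lambda>p. \<Sum>x\<in>set_pmf \<mu>. pmf \<mu> x * poly_eval p x)"
    by (intro linearI) (simp_all add: linear_add[OF linear_poly_eval]
      linear_scale[OF linear_poly_eval] sum.distrib sum_distrib_left algebra_simps)
next
  fix q :: "'d rpoly" assume "q \<in> mon ` multi_indices N"
  then obtain \<alpha> where a: "q = mon \<alpha>" "\<alpha> \<in> multi_indices N" by blast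
  have "measure_pmf.expectation \<mu> (monomial_eval \<alpha>) =
      (\<Sum>x\<in>set_pmf \<mu>. monomial_eval \<alpha> x * pmf \<mu> x)"
    using assms by (intro integral_measure_pmf_real) (auto simp: represents_def)
  then show "riesz \<phi> q = (\<Sum>x\<in>set_pmf \<mu>. pmf \<mu> x * poly_eval q x)"
    using assms a by (simp add: represents_def mult.commute)
qed

text \<open>The columns of the moment matrix are combinations of the vectors of monomial values at
  the atoms. As the rank equals the number of atoms, these vectors are independent, and dual
  functionals yield interpolating polynomials.\<close>

lemma interpolation_at_atoms:
  fixes \<phi> :: "nat ^ 'd::finite \<Rightarrow> real"
  assumes rep: "represents (2 * k) \<phi> \<mu>" and rank: "moment_rank k \<phi> = card (set_pmf \<mu>)"
  shows "\<exists>q\<in>polys_le k. \<forall>y\<in>set_pmf \<mu>. poly_eval q y = (if y = x then 1 else 0)"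
proof -
  define S where "S = set_pmf \<mu>"
  \<comment> \<open>The vector of monomial values at \<open>y\<close>, stored as a polynomial with
    these coefficients.\<close>
  define ev where "ev y = (\<Sum>\<alpha>\<in>multi_indices k. monomial_eval \<alpha> y *\<^sub>R mon \<alpha>)" for y :: "real ^ 'd"
  have fin: "finite S" using rep by (simp add: represents_def S_def)
  have col: "(\<Sum>\<alpha>\<in>multi_indices k. Poly_Mapping.single \<alpha> (moment_matrix \<phi> \<alpha> \<beta>)) \<in> span (ev ` S)"
    if "\<beta> \<in> multi_indices k" for \<beta>
  proof -
    have phi: "\<phi> (\<alpha> + \<beta>) = (\<Sum>y\<in>S. pmf \<mu> y * (monomial_eval \<alpha> y * monomial_eval \<beta> y))"
      if "\<alpha> \<in> multi_indices k" for \<alpha>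
      using represents_riesz[OF rep, of "mon (\<alpha> + \<beta>)"] that \<open>\<beta> \<in> multi_indices k\<close>
      by (simp add: mon_mem_polys_le multi_indices_def mdeg_add monomial_eval_add S_def)
    have "(\<Sum>\<alpha>\<in>multi_indices k. Poly_Mapping.single \<alpha> (moment_matrix \<phi> \<alpha> \<beta>)) =
        (\<Sum>\<alpha>\<in>multi_indices k. \<phi> (\<alpha> + \<beta>) *\<^sub>R mon \<alpha>)"
      by (simp only: moment_matrix_def single_eq_scaleR[of _ "\<phi> _"])
    also have "\<dots> = (\<Sum>\<alpha>\<in>multi_indices k. \<Sum>y\<in>S. (pmf \<mu> y * (monomial_eval \<alpha> y * monomial_eval \<beta> y)) *\<^sub>R mon \<alpha>)"
      by (intro sum.cong) (simp_all add: phi scaleR_sum_left)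
    also have "\<dots> = (\<Sum>y\<in>S. (pmf \<mu> y * monomial_eval \<beta> y) *\<^sub>R ev y)"
      unfolding ev_def by (subst sum.swap) (simp add: scaleR_sum_right mult_ac)
    also have "\<dots> \<in> span (ev ` S)"
      by (intro span_sum span_scale span_base) auto
    finally show ?thesis .
  qed
  \<comment> \<open>Applied to the whole image of \<open>ev\<close> this gives injectivity; applied
    to that image without one vector it gives independence.\<close>
  have le: "card S \<le> card T" if "finite T" "span (ev ` S) \<subseteq> span T" for T
  proof -
    have "moment_rank k \<phi> \<le> card T"
      unfolding moment_rank_def rank_on_def
      using col that by (intro dim_le_card) auto
    then show ?thesis using rank by (simp add: S_def)
  qed
  have "card S \<le> card (ev ` S)" using fin by (intro le) auto
  then have card: "card (ev ` S) = card S" using card_image_le[OF fin, of ev] by simp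
  then have inj: "inj_on ev S" using fin by (rule eq_card_imp_inj_on[rotated])
  have ind: "independent (ev ` S)"
  proof
    assume "dependent (ev ` S)"
    then obtain a where a: "a \<in> ev ` S" "a \<in> span (ev ` S - {a})" by (auto simp: dependent_def)
    have "span (ev ` S) \<subseteq> span (ev ` S - {a})"
    proof (intro span_minimal subspace_span subsetI)
      fix z assume "z \<in> ev ` S"
      then show "z \<in> span (ev ` S - {a})" using a(2) by (cases "z = a") (auto intro: span_base)
    qed
    then have "card S \<le> card (ev ` S - {a})" using fin by (intro le) auto
    also have "\<dots> < card (ev ` S)" using a fin by (intro card_Diff1_less) auto
    finally show False using card by simp
  qed
  \<comment> \<open>The conjunct \<open>x \<in> S\<close> covers a point that is no atom; all
    prescribed values are then zero.\<close>
  obtain F :: "'d rpoly \<Rightarrow> real" where F: "linear F" "\<And>z. z \<in> ev ` S \<Longrightarrow> F z = (if z = ev x \<and> x \<in> S then 1 else 0)"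
    using linear_independent_extend[OF ind, of "\<lambda>z. if z = ev x \<and> x \<in> S then 1 else 0"] by blast
  define q where "q = (\<Sum>\<alpha>\<in>multi_indices k. F (mon \<alpha>) *\<^sub>R mon \<alpha>)"
  have "q \<in> polys_le k"
    unfolding q_def polys_le_def by (intro span_sum span_scale span_base) auto
  moreover have "poly_eval q y = F (ev y)" for y
    unfolding q_def ev_def
    by (simp add: linear_sum[OF linear_poly_eval] linear_scale[OF linear_poly_eval]
        linear_sum[OF F(1)] linear_scale[OF F(1)] mult.commute)
  moreover have "F (ev y) = (if y = x then 1 else 0)" if "y \<in> S" for y
    using F(2)[of "ev y"] that inj by (auto simp: inj_on_def)
  ultimately show ?thesis by (intro bexI[of _ q]) (simp_all add: S_def)
qed

text \<open>If \<open>q\<close> is 1 at \<open>x\<close> and 0 at the other atoms, then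
  \<open>riesz \<phi> (q * q * g)\<close> is the weight of \<open>x\<close> times the value of
  \<open>g\<close> there.\<close>

lemma nonneg_at_atoms:
  assumes rep: "represents N \<phi> \<mu>" and rank: "moment_rank k \<phi> = card (set_pmf \<mu>)"
    and deg: "total_degree g + 2 * k \<le> N"
    and psd: "psd_on (multi_indices k) (localizing_matrix g \<phi>)"
    and x: "x \<in> set_pmf \<mu>"
  shows "0 \<le> poly_eval g x"
proof -
  have "represents (2 * k) \<phi> \<mu>" using rep deg by (auto intro: represents_mono)
  then obtain q where q: "q \<in> polys_le k"
    "\<And>y. y \<in> set_pmf \<mu> \<Longrightarrow> poly_eval q y = (if y = x then 1 else 0)"
    using interpolation_at_atoms[OF _ rank] by blast
  have "g \<in> polys_le (total_degree g)" by (simp add: mem_polys_le_iff)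
  then have "q * q * g \<in> polys_le (k + k + total_degree g)" using q by (intro polys_le_mult)
  then have mem: "q * q * g \<in> polys_le N" using polys_le_mono[of "k + k + total_degree g" N] deg by auto
  have "0 \<le> riesz \<phi> (q * q * g)" using psd q(1) by (rule psd_localizing_nonneg)
  also have "\<dots> = (\<Sum>y\<in>set_pmf \<mu>. pmf \<mu> y * poly_eval (q * q * g) y)"
    by (rule represents_riesz[OF rep mem])
  also have "\<dots> = (\<Sum>y\<in>set_pmf \<mu>. if y = x then pmf \<mu> x * poly_eval g x else 0)"
    by (intro sum.cong) (auto simp: poly_eval_mult q(2))
  also have "\<dots> = pmf \<mu> x * poly_eval g x"
    using rep x by (simp add: represents_def)
  finally show ?thesis using x pmf_positive[of x \<mu>] by (simp add: zero_le_mult_iff)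
qed

section \<open>Truncated multiplication and its joint eigenvectors\<close>

context truncated_moments
begin

lemma basis_0:
  assumes "\<phi> 0 = 1"
  shows "basis 0 {1}"
proof -
  have mi: "multi_indices 0 = {0 :: nat ^ 'd}" by (auto simp: multi_indices_def mdeg_eq_0_iff)
  have P: "polys_le 0 = span {1 :: 'd rpoly}" by (simp add: polys_le_def mi)
  have "orthonormal {1}" using assms by (simp add: orthonormal_def form_def)
  then show ?thesis
    using proj_id[of "{1}"] by (auto simp: basis_def P complete_for_def span_base form_simps)
qed

text \<open>The rank of order 0 is 1, and each strict step adds at least 1.\<close>

lemma rank_strict_ge:
  assumes "\<phi> 0 = 1" "k \<le> n" "\<And>j. j < k \<Longrightarrow> moment_rank j \<phi> \<noteq> moment_rank (Suc j) \<phi>"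
  shows "Suc k \<le> moment_rank k \<phi>"
  using assms(2,3)
proof (induction k)
  case 0
  show ?case using moment_rank_eq_card[OF basis_0[OF assms(1)]] by simp
next
  case (Suc k)
  then show ?case using moment_rank_mono[of k "Suc k"] Suc.prems(2)[of k] by fastforce
qed

text \<open>The compression of multiplication by a variable to \<open>span E\<close>. In one
  variable and with respect to orthonormal polynomials, its matrix is the Jacobi matrix of Gauss
  quadrature.\<close>

definition mult_op :: "'d rpoly set \<Rightarrow> 'd \<Rightarrow> 'd rpoly \<Rightarrow> 'd rpoly" where
  "mult_op E i p = proj E (var i * p)"

lemma linear_mult_op: "linear (mult_op E i)"
  using linear_compose[OF linear_mult linear_proj] by (simp add: mult_op_def[abs_def] o_def)

lemma mult_op_mem: "mult_op E i p \<in> span E"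
  by (simp add: mult_op_def proj_mem)

lemma form_mult_op:
  assumes "basis k E" "k < n" "x \<in> polys_le k" "y \<in> polys_le k"
  shows "form (mult_op E i x) y = form (var i * x) y"
  unfolding mult_op_def using assms by (intro form_proj_low[of k]) (auto intro: var_mult_mem)

text \<open>The commutator has values in \<open>span E\<close>, where only zero is orthogonal to
  \<open>E\<close>; so it suffices to compare matrix entries.\<close>

lemma mult_op_commute:
  assumes E: "basis k E" and k: "Suc k = n"
    and orth: "\<And>e e'. e \<in> E \<Longrightarrow> e' \<in> E \<Longrightarrow>
      form (mult_op E i (mult_op E j e)) e' = form (mult_op E j (mult_op E i e)) e'"
    and x: "x \<in> span E"
  shows "mult_op E i (mult_op E j x) = mult_op E j (mult_op E i x)"
proof (rule linear_eq_on_span[OF _ _ _ x])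
  have lin: "linear (\<lambda>x. mult_op E i (mult_op E j x))" for i j
    using linear_compose[OF linear_mult_op linear_mult_op] by (simp add: o_def)
  show "linear (\<lambda>x. mult_op E i (mult_op E j x))" by (rule lin)
  show "linear (\<lambda>x. mult_op E j (mult_op E i x))" by (rule lin)
next
  fix e assume e: "e \<in> E"
  define d where "d = mult_op E i (mult_op E j e) - mult_op E j (mult_op E i e)"
  have "d \<in> span E" unfolding d_def by (intro span_diff mult_op_mem)
  then have "proj E d = d" using E by (intro proj_id) (auto simp: basis_def)
  moreover have "form e' d = 0" if "e' \<in> E" for e'
    using orth[OF e that] sym[of e'] by (simp add: d_def form_simps)
  then have "proj E d = 0" by (simp add: proj_def)
  ultimately show "mult_op E i (mult_op E j e) = mult_op E j (mult_op E i e)"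
    by (simp add: d_def)
qed

text \<open>As \<open>E\<close> is complete up to degree \<open>n\<close>, the inner projection does
  not affect the matrix entries, which become \<open>form (var j * e) (var i * e')\<close> and are
  symmetric in \<open>i\<close> and \<open>j\<close>.\<close>

lemma mult_op_commute_flat:
  assumes E: "basis k E" "basis n E" and k: "Suc k = n" and x: "x \<in> span E"
  shows "mult_op E i (mult_op E j x) = mult_op E j (mult_op E i x)"
proof (rule mult_op_commute[OF E(1) k _ x])
  fix e e' assume e: "e \<in> E" "e' \<in> E"
  have sp: "\<And>p. p \<in> span E \<Longrightarrow> p \<in> polys_le k" using span_basis[OF E(1)] by blast
  have ek: "e \<in> polys_le k" "e' \<in> polys_le k" using e E by (auto simp: basis_def)
  have vn: "var i * p \<in> polys_le n" if "p \<in> polys_le k" for i p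
    using that k by (intro var_mult_mem) auto
  have "form (mult_op E i (mult_op E j e)) e' = form (var j * e) (var i * e')" for i j
  proof -
    have "form (mult_op E i (mult_op E j e)) e' = form (mult_op E j e) (var i * e')"
      using form_mult_op[OF E(1), of "mult_op E j e" e' i] k ek sp mult_op_mem
      by (simp add: form_var_shift[of i "mult_op E j e"])
    also have "\<dots> = form (var j * e) (var i * e')"
      unfolding mult_op_def using ek vn by (intro form_proj[OF E(2)]) auto
    finally show ?thesis .
  qed
  then show "form (mult_op E i (mult_op E j e)) e' = form (mult_op E j (mult_op E i e)) e'"
    by (simp add: form_def mult_ac)
qed

text \<open>
  The commutator defines an antisymmetric form, which vanishes on polynomials of degree at most
  \<open>n - 2\<close>. If these have codimension at most one in the quotient, it vanishes altogether.
\<close>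

lemma mult_op_commute_codim_1:
  assumes E: "basis k E" and k: "Suc k = n"
    and G: "G \<subseteq> E" "card E \<le> Suc (card G)" "\<And>e j. e \<in> G \<Longrightarrow> var j * e \<in> polys_le k"
    and x: "x \<in> span E"
  shows "mult_op E i (mult_op E j x) = mult_op E j (mult_op E i x)"
proof (rule mult_op_commute[OF E k _ x])
  have sp: "\<And>p. p \<in> span E \<Longrightarrow> p \<in> polys_le k" using span_basis[OF E] by blast
  have Ek: "e \<in> polys_le k" if "e \<in> E" for e using that E by (auto simp: basis_def)
  define D where "D e e' = form (mult_op E i (mult_op E j e)) e' - form (mult_op E j (mult_op E i e)) e'" for e e'
  \<comment> \<open>Self-adjointness of the outer operator, from which the antisymmetry of the
    commutator follows.\<close>
  have shift: "form (mult_op E i (mult_op E j e)) e' = form (mult_op E j e) (mult_op E i e')"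
    if "e \<in> E" "e' \<in> E" for e e' i j
  proof -
    have "form (mult_op E i (mult_op E j e)) e' = form (mult_op E j e) (var i * e')"
      using form_mult_op[OF E, of "mult_op E j e" e' i] k Ek that sp mult_op_mem
      by (simp add: form_var_shift[of i "mult_op E j e"])
    also have "\<dots> = form (var i * e') (mult_op E j e)" by (rule sym)
    also have "\<dots> = form (mult_op E i e') (mult_op E j e)"
      using form_mult_op[OF E, of e' "mult_op E j e" i] k Ek that sp mult_op_mem by simp
    also have "\<dots> = form (mult_op E j e) (mult_op E i e')" by (rule sym)
    finally show ?thesis .
  qed
  have anti: "D e e' = - D e' e" if "e \<in> E" "e' \<in> E" for e e'
    unfolding D_def
    using shift[OF that, of i j] shift[OF that, of j i] shift[OF that(2,1), of i j]
      shift[OF that(2,1), of j i] sym[of "mult_op E j e" "mult_op E i e'"]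
      sym[of "mult_op E i e" "mult_op E j e'"] by linarith
  \<comment> \<open>For \<open>e\<close> in \<open>G\<close> the product with a variable has degree
    at most \<open>k\<close>, so its projection differs from it by a null vector.\<close>
  have low: "D e e' = 0" if e: "e \<in> G" "e' \<in> E" for e e'
  proof -
    have "form (mult_op E i (mult_op E j e)) e' = form (var j * e) (var i * e')" for i j
    proof -
      have "form (mult_op E i (mult_op E j e)) e' = form (mult_op E j e) (var i * e')"
        using form_mult_op[OF E, of "mult_op E j e" e' i] k Ek that sp mult_op_mem
        by (simp add: form_var_shift[of i "mult_op E j e"])
      also have "\<dots> = form (var j * e) (var i * e')"
        unfolding mult_op_def using G(3)[OF e(1)] Ek[OF e(2)] k
        by (intro form_proj[OF E]) (auto intro: var_mult_mem)
      finally show ?thesis .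
    qed
    then show ?thesis unfolding D_def by (simp add: form_def mult_ac)
  qed
  fix e e' assume e: "e \<in> E" "e' \<in> E"
  have "D e e' = 0"
  proof (cases "e \<in> G \<or> e' \<in> G")
    case True
    then show ?thesis using low e anti[OF e] by auto
  next
    case False
    have finE: "finite E" using E by (simp add: basis_def)
    \<comment> \<open>At most one element of \<open>E\<close> lies outside \<open>G\<close>. Only a
      diagonal entry is left, and antisymmetry makes it zero.\<close>
    have "card (E - G) \<le> 1"
      using G finE card_Diff_subset[of G E] finite_subset[OF G(1) finE] by simp
    then have "e = e'" using False e finE card_le_Suc0_iff_eq[of "E - G"] by auto
    then show ?thesis using anti[OF e(1) e(1)] by simp
  qed
  then show "form (mult_op E i (mult_op E j e)) e' = form (mult_op E j (mult_op E i e)) e'"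
    by (simp add: D_def)
qed

text \<open>The atoms are the tuples of joint eigenvalues, and the atom of \<open>e\<close> has
  weight \<open>(form e 1)\<^sup>2\<close>. Parseval's identity at two monomials becomes a
  quadrature formula: one of them may have degree up to \<open>n\<close>, the other up to the degree
  where the basis is complete.\<close>

lemma representing_measure:
  assumes n: "Suc k = n" and one: "\<phi> 0 = 1"
    and E0: "basis k E0"
    and comm: "\<And>i j x. x \<in> span E0 \<Longrightarrow>
      mult_op E0 i (mult_op E0 j x) = mult_op E0 j (mult_op E0 i x)"
  shows "\<exists>\<mu>. represents (k + n) \<phi> \<mu> \<and> card (set_pmf \<mu>) = moment_rank k \<phi> \<and>
           (basis n E0 \<longrightarrow> represents (2 * n) \<phi> \<mu>)"
proof -
  have kn: "k < n" "k \<le> n" "polys_le k \<subseteq> polys_le n" using n polys_le_mono[of k n] by auto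
  have span0: "\<And>p. p \<in> span E0 \<Longrightarrow> p \<in> polys_le k" using span_basis[OF E0] by blast
  have on0: "orthonormal E0" "finite E0" using E0 by (auto simp: basis_def)
  have "form (mult_op E0 i x) y = form x (mult_op E0 i y)" if "x \<in> span E0" "y \<in> span E0" for i x y
  proof -
    have "form (mult_op E0 i x) y = form y (var i * x)"
      using form_mult_op[OF E0 kn(1)] span0 that sym by metis
    also have "\<dots> = form (mult_op E0 i y) x"
      using form_mult_op[OF E0 kn(1), of y x i] span0 that by (simp add: form_var_shift[of i y])
    finally show ?thesis using sym by metis
  qed
  then obtain E where E: "orthonormal E" "finite E" "span E = span E0" "card E = card E0"
    and eigen: "\<And>e i. e \<in> E \<Longrightarrow> \<exists>\<kappa>. mult_op E0 i e = \<kappa> *\<^sub>R e"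
    using orthonormal_eigenbasis[OF on0, of "mult_op E0"] linear_mult_op mult_op_mem comm by blast
  define atom where "atom e = (\<chi> i. SOME \<kappa>. mult_op E0 i e = \<kappa> *\<^sub>R e)" for e
  have atom: "mult_op E0 i e = (atom e $ i) *\<^sub>R e" if "e \<in> E" for e i
    using someI_ex[OF eigen[OF that]] by (simp add: atom_def)
  have Ek: "e \<in> polys_le k" if "e \<in> E" for e
    using that span_base[of e E] E(3) span0 by auto
  define w where "w e = form e 1" for e
  \<comment> \<open>Splitting off a variable leaves a monomial of degree at most \<open>k\<close>,
    against which multiplying \<open>e\<close> by the variable acts as the eigenvalue. The formula
    thus reaches degree \<open>n\<close>, one more than \<open>k\<close>.\<close>
  have moment: "form e (mon \<alpha>) = monomial_eval \<alpha> (atom e) * w e" if "e \<in> E" "mdeg \<alpha> \<le> n" for e \<alpha>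
    using that(2)
  proof (induction "mdeg \<alpha>" arbitrary: \<alpha>)
    case 0
    then show ?case using mdeg_eq_0_iff[of \<alpha>] by (simp add: w_def)
  next
    case (Suc l)
    obtain i \<beta> where b: "\<alpha> = axis i (Suc 0) + \<beta>" "mdeg \<beta> = l"
      using Suc.hyps(2) by (metis mdeg_SucE)
    have bk: "mon \<beta> \<in> polys_le k" using b Suc n by (intro mon_mem_polys_le) (simp add: multi_indices_def)
    have "form e (mon \<alpha>) = form (var i * e) (mon \<beta>)"
      by (simp add: form_var_shift mon_mult b)
    also have "\<dots> = form (mult_op E0 i e) (mon \<beta>)"
      using form_mult_op[OF E0 kn(1) Ek[OF that(1)] bk] by simp
    also have "\<dots> = atom e $ i * form e (mon \<beta>)"
      by (simp add: atom[OF that(1)] form_simps)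
    also have "form e (mon \<beta>) = monomial_eval \<beta> (atom e) * w e"
      using Suc b by simp
    finally show ?case by (simp add: b monomial_eval_add monomial_eval_axis)
  qed
  have proj_eq: "proj E x = proj E0 x" if x: "x \<in> polys_le n" "form (x - proj E0 x) (x - proj E0 x) = 0" for x :: "'d rpoly"
    using proj_eqI[OF subspace_polys_le form_nonneg E(1,2) _ x(1) _ x(2)]
      Ek kn(3) E(3) proj_mem[of E0 x] by blast
  have basis_E: "basis l E" if l: "k \<le> l" "l \<le> n" "basis l E0" for l
    unfolding basis_def
  proof (intro conjI E)
    show "E \<subseteq> polys_le l" using Ek polys_le_mono[OF l(1)] by blast
    show "complete_for E (polys_le l)"
      unfolding complete_for_def
    proof
      fix x :: "'d rpoly" assume x: "x \<in> polys_le l"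
      then have *: "form (x - proj E0 x) (x - proj E0 x) = 0"
        using l by (auto simp: basis_def complete_for_def)
      have "x \<in> polys_le n" using x polys_le_mono[OF l(2)] by blast
      from proj_eq[OF this *] * show "form (x - proj E x) (x - proj E x) = 0" by simp
    qed
  qed
  have quad: "\<phi> (\<alpha> + \<beta>) = (\<Sum>e\<in>E. monomial_eval (\<alpha> + \<beta>) (atom e) * (w e)\<^sup>2)"
    if "basis l E" "l \<le> n" "mdeg \<alpha> \<le> l" "mdeg \<beta> \<le> n" for l and \<alpha> \<beta> :: "nat ^ 'd"
  proof -
    have "form (mon \<alpha>) (mon \<beta>) = (\<Sum>e\<in>E. form e (mon \<alpha>) * form e (mon \<beta>))"
      using that by (intro parseval[of l]) (auto intro!: mon_mem_polys_le simp: multi_indices_def)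
    also have "\<dots> = (\<Sum>e\<in>E. monomial_eval (\<alpha> + \<beta>) (atom e) * (w e)\<^sup>2)"
      using that by (intro sum.cong) (auto simp: moment monomial_eval_add power2_eq_square)
    finally show ?thesis by simp
  qed
  \<comment> \<open>Excludes zero weights and coinciding atoms: either would make a nonzero element
    of \<open>span E\<close> orthogonal to all monomials of degree at most \<open>k\<close>.\<close>
  have null: False if z: "z \<in> span E" "\<And>\<alpha>. mdeg \<alpha> \<le> k \<Longrightarrow> form z (mon \<alpha>) = 0" "z \<noteq> 0" for z
  proof -
    have "form z y = 0" if "y \<in> polys_le k" for y
      using that unfolding polys_le_def
      by (rule null_on_span[rotated]) (auto simp: multi_indices_def z(2))
    moreover have "z \<in> polys_le k" using z(1) E(3) span0 by simp
    ultimately have "form z z = 0" by blast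
    then show False using orthonormal_pos[OF E(1,2) z(1,3)] by simp
  qed
  have nz: "e \<noteq> 0" if "e \<in> E" for e
  proof
    assume "e = 0"
    then have "form e e = 0" by (simp add: form_simps)
    then show False using that E(1) by (simp add: orthonormal_def)
  qed
  have wnz: "w e \<noteq> 0" if e: "e \<in> E" for e
    using null[OF span_base[OF e] _ nz[OF e]] moment[OF e] kn by fastforce
  have inj: "inj_on atom E"
  proof (rule inj_onI, rule ccontr)
    fix e e' assume e: "e \<in> E" "e' \<in> E" "atom e = atom e'" "e \<noteq> e'"
    \<comment> \<open>The crosswise weights cancel the values at the common atom.\<close>
    define z where "z = w e' *\<^sub>R e - w e *\<^sub>R e'"
    have "z \<in> span E" unfolding z_def using e by (intro span_diff span_scale span_base)
    moreover have "form z (mon \<alpha>) = 0" if "mdeg \<alpha> \<le> k" for \<alpha>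
      using that kn moment[OF e(1), of \<alpha>] moment[OF e(2), of \<alpha>] e(3) by (simp add: z_def form_simps)
    moreover have "form z e = w e'" using e E(1) by (simp add: z_def form_simps orthonormal_def)
    then have "z \<noteq> 0" using wnz[OF e(2)] by (auto simp: form_simps)
    ultimately show False by (rule null)
  qed
  have Ebk: "basis k E" by (rule basis_E) (use kn E0 in auto)
  have "(\<Sum>x\<in>atom ` E. (w (the_inv_into E atom x))\<^sup>2) = (\<Sum>e\<in>E. (w e)\<^sup>2)"
    by (simp add: sum.reindex[OF inj] the_inv_into_f_f[OF inj])
  also have "\<dots> = 1" using quad[OF Ebk kn(2), of 0 0] one by simp
  finally have sum1: "(\<Sum>x\<in>atom ` E. (w (the_inv_into E atom x))\<^sup>2) = 1" .
  have pos: "0 < (w (the_inv_into E atom x))\<^sup>2" if "x \<in> atom ` E" for x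
    using that wnz the_inv_into_f_f[OF inj] by auto
  obtain \<mu> where mu: "set_pmf \<mu> = atom ` E"
    "\<And>x. x \<in> atom ` E \<Longrightarrow> pmf \<mu> x = (w (the_inv_into E atom x))\<^sup>2"
    using ex_pmf_finite[OF finite_imageI[OF E(2)] pos sum1] by blast
  have rep: "represents (l + n) \<phi> \<mu>" if l: "basis l E" "l \<le> n" for l
    unfolding represents_def
  proof (intro conjI ballI)
    show "finite (set_pmf \<mu>)" using mu(1) E(2) by simp
    fix \<gamma> :: "nat ^ 'd" assume "\<gamma> \<in> multi_indices (l + n)"
    then obtain \<alpha> \<beta> where g: "\<gamma> = \<alpha> + \<beta>" "mdeg \<alpha> \<le> l" "mdeg \<beta> \<le> n"
      by (rule multi_indices_split) (auto simp: multi_indices_def)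
    have "measure_pmf.expectation \<mu> (monomial_eval \<gamma>) = (\<Sum>x\<in>atom ` E. monomial_eval \<gamma> x * pmf \<mu> x)"
      using mu(1) E(2) by (intro integral_measure_pmf_real) auto
    also have "\<dots> = (\<Sum>e\<in>E. monomial_eval \<gamma> (atom e) * (w e)\<^sup>2)"
      by (simp add: sum.reindex[OF inj] mu(2) the_inv_into_f_f[OF inj])
    also have "\<dots> = \<phi> \<gamma>" unfolding g(1) by (rule quad[OF l g(2,3), symmetric])
    finally show "\<phi> \<gamma> = measure_pmf.expectation \<mu> (monomial_eval \<gamma>)" by simp
  qed
  have "card (set_pmf \<mu>) = moment_rank k \<phi>"
    using mu(1) card_image[OF inj] E(4) moment_rank_eq_card[OF E0 kn(2)] by simp
  moreover have "represents (k + n) \<phi> \<mu>" using rep[OF Ebk kn(2)] .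
  moreover have "represents (2 * n) \<phi> \<mu>" if "basis n E0"
    using rep[of n] basis_E[OF kn(2) _ that] by (simp add: mult_2)
  ultimately show ?thesis by blast
qed

text \<open>
  For \<open>n = 1\<close> the construction above gives a single atom, which misses the second moments if the
  moment matrix of order \<open>1\<close> has rank \<open>2\<close>; two symmetric atoms around the mean then represent them.
\<close>

lemma representing_measure_order_1:
  assumes n: "n = 1" and one: "\<phi> 0 = 1" and rank: "moment_rank n \<phi> = 2"
  shows "\<exists>\<mu>. represents 2 \<phi> \<mu> \<and> card (set_pmf \<mu>) = 2"
proof -
  obtain E where E: "basis n E" "{1} \<subseteq> E" using basis_chain[OF basis_0[OF one], of n] by auto
  then have "card E = 2" using rank moment_rank_eq_card[OF E(1)] by simp
  then obtain e where e: "E = {1, e}" "e \<noteq> 1" using E(2) by (auto simp: card_2_iff)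
  have on: "form 1 1 = 1" "form e e = 1" "form e 1 = 0"
    using E(1) e by (auto simp: basis_def orthonormal_def)
  \<comment> \<open>For \<open>t = 1\<close> and \<open>t = -1\<close> this is the mean plus and
    minus the vector of coefficients of the variables along \<open>e\<close>.\<close>
  define atom where "atom t = (\<chi> i. form (1 + t *\<^sub>R e) (var i))" for t
  have ev: "monomial_eval \<alpha> (atom t) = form (1 + t *\<^sub>R e) (mon \<alpha>)" if "mdeg \<alpha> \<le> 1" for \<alpha> t
  proof (cases "mdeg \<alpha>")
    case 0
    then show ?thesis using on mdeg_eq_0_iff[of \<alpha>] by (simp add: form_simps)
  next
    case (Suc l)
    then obtain i \<beta> where "\<alpha> = axis i (Suc 0) + \<beta>" "mdeg \<beta> = l" by (rule mdeg_SucE)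
    then have "\<alpha> = axis i (Suc 0)" using Suc that mdeg_eq_0_iff[of \<beta>] by simp
    then show ?thesis by (simp add: monomial_eval_axis atom_def)
  qed
  \<comment> \<open>Equal atoms would make \<open>e\<close> orthogonal to all polynomials of degree
    at most 1, itself included.\<close>
  have "atom 1 \<noteq> atom (-1)"
  proof
    assume eq: "atom 1 = atom (-1)"
    have mon: "form e (mon \<alpha>) = 0" if "mdeg \<alpha> \<le> 1" for \<alpha>
      using ev[OF that, of 1] ev[OF that, of "-1"] eq by (simp add: form_simps)
    have "form e y = 0" if "y \<in> polys_le n" for y
      using that unfolding polys_le_def
      by (rule null_on_span[rotated]) (auto simp: multi_indices_def n mon)
    then show False using E e on by (auto simp: basis_def)
  qed
  then have A: "card {atom 1, atom (-1)} = 2" by simp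
  define \<mu> where "\<mu> = pmf_of_set {atom 1, atom (-1)}"
  have supp: "set_pmf \<mu> = {atom 1, atom (-1)}" by (simp add: \<mu>_def)
  have "\<phi> \<gamma> = measure_pmf.expectation \<mu> (monomial_eval \<gamma>)" if "\<gamma> \<in> multi_indices 2" for \<gamma>
  proof -
    have "\<gamma> \<in> multi_indices (1 + 1)" using that by (simp add: multi_indices_def)
    then obtain \<alpha> \<beta> where g: "\<gamma> = \<alpha> + \<beta>" "mdeg \<alpha> \<le> 1" "mdeg \<beta> \<le> 1"
      by (rule multi_indices_split) (auto simp: multi_indices_def)
    have "form (mon \<alpha>) (mon \<beta>) = (\<Sum>e\<in>E. form e (mon \<alpha>) * form e (mon \<beta>))"
      using E g n by (intro parseval[of n]) (auto intro!: mon_mem_polys_le simp: multi_indices_def)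
    then have "\<phi> \<gamma> = form 1 (mon \<alpha>) * form 1 (mon \<beta>) + form e (mon \<alpha>) * form e (mon \<beta>)"
      using e by (simp add: g)
    \<comment> \<open>The mixed terms for \<open>t = 1\<close> and \<open>t = -1\<close>
      cancel.\<close>
    also have "\<dots> = (monomial_eval \<gamma> (atom 1) + monomial_eval \<gamma> (atom (-1))) / 2"
      by (simp add: g(1) monomial_eval_add ev[OF g(2)] ev[OF g(3)] form_simps field_simps)
    also have "\<dots> = measure_pmf.expectation \<mu> (monomial_eval \<gamma>)"
      using \<open>atom 1 \<noteq> atom (-1)\<close> A by (simp add: \<mu>_def integral_pmf_of_set)
    finally show ?thesis .
  qed
  then have "represents 2 \<phi> \<mu>" using supp unfolding represents_def by simp
  then show ?thesis using supp A by auto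
qed

text \<open>Combines the two commutation criteria; in the second one a basis of order
  \<open>k - 1\<close> is extended to one of order \<open>k\<close>.\<close>

lemma representing_measure_if_rank:
  assumes n: "Suc k = n" and one: "\<phi> 0 = 1"
    and rank: "moment_rank k \<phi> = moment_rank n \<phi> \<or> k = 0 \<or>
      moment_rank k \<phi> \<le> Suc (moment_rank (k - 1) \<phi>)"
  shows "\<exists>\<mu>. represents (k + n) \<phi> \<mu> \<and> card (set_pmf \<mu>) = moment_rank k \<phi> \<and>
           (moment_rank k \<phi> = moment_rank n \<phi> \<longrightarrow> represents (2 * n) \<phi> \<mu>)"
proof (cases "moment_rank k \<phi> = moment_rank n \<phi>")
  case True
  obtain E where E: "basis k E" using basis_ex[of k] n by auto
  then have "basis n E" using basis_if_rank_eq[OF E _ _ True] n by simp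
  then show ?thesis
    using representing_measure[OF n one E] mult_op_commute_flat[OF E _ n] by blast
next
  case False
  have "\<exists>E G. basis k E \<and> G \<subseteq> E \<and> card E \<le> Suc (card G) \<and> (\<forall>e\<in>G. \<forall>j. var j * e \<in> polys_le k)"
  proof (cases k)
    case 0
    \<comment> \<open>The quotient is spanned by 1, so the empty \<open>G\<close> already has
      codimension one.\<close>
    then show ?thesis using basis_0[OF one] by (intro exI[of _ "{1}"] exI[of _ "{}"]) auto
  next
    case (Suc l)
    obtain G where G: "basis l G" using basis_ex[of l] n Suc by auto
    then obtain E where E: "basis k E" "G \<subseteq> E" using basis_chain[OF G, of k] n Suc by auto
    have "card E \<le> Suc (card G)"
      using False rank Suc n moment_rank_eq_card[OF G] moment_rank_eq_card[OF E(1)] by simp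
    moreover have "var j * e \<in> polys_le k" if "e \<in> G" for e j
      using that G Suc by (intro var_mult_mem[of e l]) (auto simp: basis_def)
    ultimately show ?thesis using E by blast
  qed
  then obtain E G where E: "basis k E" "G \<subseteq> E" "card E \<le> Suc (card G)"
    "\<And>e j. e \<in> G \<Longrightarrow> var j * e \<in> polys_le k" by blast
  then show ?thesis
    using representing_measure[OF n one E(1)] mult_op_commute_codim_1[OF E(1) n E(2-4)] False by blast
qed

end

section \<open>Point evaluations in the relaxation and optimal atoms\<close>

lemma psd_on_subset:
  assumes "psd_on I A" "J \<subseteq> I" "finite I"
  shows "psd_on J A"
  unfolding psd_on_def
proof (intro conjI allI)
  show "\<forall>\<alpha>\<in>J. \<forall>\<beta>\<in>J. A \<alpha> \<beta> = A \<beta> \<alpha>" using assms by (auto simp: psd_on_def)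
  fix c :: "'a \<Rightarrow> real"
  define c' where "c' \<alpha> = (if \<alpha> \<in> J then c \<alpha> else 0)" for \<alpha>
  have "0 \<le> (\<Sum>\<alpha>\<in>I. \<Sum>\<beta>\<in>I. c' \<alpha> * A \<alpha> \<beta> * c' \<beta>)" using assms(1) by (simp add: psd_on_def)
  also have "\<dots> = (\<Sum>\<alpha>\<in>J. \<Sum>\<beta>\<in>I. c' \<alpha> * A \<alpha> \<beta> * c' \<beta>)"
    using assms by (intro sum.mono_neutral_right) (auto simp: c'_def)
  also have "\<dots> = (\<Sum>\<alpha>\<in>J. \<Sum>\<beta>\<in>J. c' \<alpha> * A \<alpha> \<beta> * c' \<beta>)"
    using assms by (intro sum.cong refl sum.mono_neutral_right) (auto simp: c'_def)
  also have "\<dots> = (\<Sum>\<alpha>\<in>J. \<Sum>\<beta>\<in>J. c \<alpha> * A \<alpha> \<beta> * c \<beta>)"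
    by (intro sum.cong) (auto simp: c'_def)
  finally show "0 \<le> (\<Sum>\<alpha>\<in>J. \<Sum>\<beta>\<in>J. c \<alpha> * A \<alpha> \<beta> * c \<beta>)" .
qed

lemma total_degree_le_half_degree: "total_degree p \<le> 2 * half_degree p"
  unfolding half_degree_def by linarith

lemma half_degree_one [simp]: "half_degree 1 = 0"
  by (simp add: half_degree_def total_degree_def)

text \<open>The matrix is \<open>poly_eval g x\<close> times the rank-one matrix of the vector of
  monomial values at \<open>x\<close>.\<close>

lemma psd_localizing_dirac:
  assumes "0 \<le> poly_eval g x"
  shows "psd_on (multi_indices k) (localizing_matrix g (\<lambda>\<alpha>. monomial_eval \<alpha> x))"
proof -
  have loc: "localizing_matrix g (\<lambda>\<alpha>. monomial_eval \<alpha> x) \<alpha> \<beta> =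
      monomial_eval \<alpha> x * monomial_eval \<beta> x * poly_eval g x" for \<alpha> \<beta>
    unfolding localizing_matrix_eq_riesz poly_eval_eq_riesz[symmetric] by (simp add: poly_eval_mult)
  have "(\<Sum>\<alpha>\<in>multi_indices k. \<Sum>\<beta>\<in>multi_indices k.
      c \<alpha> * (monomial_eval \<alpha> x * monomial_eval \<beta> x * poly_eval g x) * c \<beta>) =
      (\<Sum>\<alpha>\<in>multi_indices k. c \<alpha> * monomial_eval \<alpha> x)\<^sup>2 * poly_eval g x" for c
    unfolding power2_eq_square sum_product
    unfolding sum_distrib_right
    by (intro sum.cong refl) (simp add: mult_ac)
  with assms show ?thesis by (simp add: psd_on_def loc mult.commute)
qed

text \<open>Makes the relaxation value a lower bound for the objective on the feasible set.\<close>

lemma relaxation_feasible_dirac: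
  assumes "x \<in> feasible_set g m"
  shows "relaxation_feasible n g m (\<lambda>\<alpha>. monomial_eval \<alpha> x)"
  using assms poly_eval_mon[of 0 x] unfolding relaxation_feasible_def feasible_set_def
  by (auto intro!: psd_localizing_dirac)

text \<open>\<open>riesz \<phi> f\<close> is the weighted mean of \<open>f\<close> over the atoms
  and bounds each value from below, so positive weights force equality at every atom.\<close>

lemma atoms_global_minimizers:
  assumes rep: "represents N \<phi> \<mu>" and f: "total_degree f \<le> N"
    and supp: "set_pmf \<mu> \<subseteq> feasible_set g m"
    and le: "\<And>x. x \<in> feasible_set g m \<Longrightarrow> riesz \<phi> f \<le> poly_eval f x"
    and x: "x \<in> set_pmf \<mu>"
  shows "poly_eval f x = riesz \<phi> f" and "global_minimizer f g m x"
proof -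
  have fin: "finite (set_pmf \<mu>)" using rep by (simp add: represents_def)
  have "(\<Sum>y\<in>set_pmf \<mu>. pmf \<mu> y * (poly_eval f y - riesz \<phi> f)) =
      (\<Sum>y\<in>set_pmf \<mu>. pmf \<mu> y * poly_eval f y) - (\<Sum>y\<in>set_pmf \<mu>. pmf \<mu> y) * riesz \<phi> f"
    by (simp add: right_diff_distrib sum_subtractf sum_distrib_right)
  also have "\<dots> = 0"
    using represents_riesz[OF rep, of f] f sum_pmf_eq_1[OF fin] by (simp add: mem_polys_le_iff)
  finally have "\<forall>y\<in>set_pmf \<mu>. pmf \<mu> y * (poly_eval f y - riesz \<phi> f) = 0"
    using le supp fin by (subst (asm) sum_nonneg_eq_0_iff) auto
  with x show eq: "poly_eval f x = riesz \<phi> f" by (auto simp: set_pmf_iff)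
  show "global_minimizer f g m x"
    using eq le x supp by (force simp: global_minimizer_def is_arg_min_def)
qed

section \<open>Exactness of the relaxation\<close>

theorem theorem2:
  fixes f :: "'d::finite rpoly"
    and g :: "nat \<Rightarrow> 'd rpoly"
    and m n v :: nat
    and \<phi> :: "nat ^ 'd \<Rightarrow> real"
  assumes "1 \<le> m"
    and "v = max_half_degree g m"
    and "v \<le> n"
    and "int (total_degree f) \<le> 2 * int n - 1"
    and "relaxation_optimal n f g m \<phi>"
    and "moment_rank n \<phi> \<le> n - v + 1"
  shows "(ereal (riesz \<phi> f) = pop_value f g m \<and>
          relaxation_value n f g m = pop_value f g m \<and>
          (\<exists>x. global_minimizer f g m x)) \<and>
         (total_degree f \<le> 2 \<and> (\<forall>j\<in>{1..m}. total_degree (g j) \<le> 2) \<longrightarrow>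
          (\<exists>k. 1 \<le> k \<and> k \<le> n \<and> flat_moments v k \<phi> \<and>
             (\<exists>\<mu>. atomic_representing k \<phi> \<mu>) \<and>
             (\<forall>\<mu>. atomic_representing k \<phi> \<mu> \<longrightarrow>
                (\<forall>x\<in>set_pmf \<mu>. global_minimizer f g m x))))"
proof -
  define r where "r k = moment_rank k \<phi>" for k
  define k where "k = n - 1"
  \<comment> \<open>The degree bound is stated over the integers and therefore excludes
    \<open>n = 0\<close>.\<close>
  have n: "Suc k = n" "k < n" "k \<le> n" using assms(4) by (auto simp: k_def)
  have feas: "relaxation_feasible n g m \<phi>"
    and opt: "\<And>\<psi>. relaxation_feasible n g m \<psi> \<Longrightarrow> riesz \<phi> f \<le> riesz \<psi> f"
    using assms(5) by (auto simp: relaxation_optimal_def is_arg_min_def not_less)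
  have one: "\<phi> 0 = 1" using feas by (simp add: relaxation_feasible_def)
  have "psd_on (multi_indices (n - half_degree ((g(0 := 1)) 0))) (localizing_matrix ((g(0 := 1)) 0) \<phi>)"
    using feas unfolding relaxation_feasible_def by (metis atLeastAtMost_iff le0)
  then have "psd_on (multi_indices n) (localizing_matrix 1 \<phi>)" by simp
  then interpret truncated_moments \<phi> n by unfold_locales
  have hd: "half_degree (g j) \<le> v" if "j \<in> {1..m}" for j
    unfolding assms(2) max_half_degree_def using that by (intro Max_ge) auto
  have psd_g: "psd_on (multi_indices l) (localizing_matrix (g j) \<phi>)"
    if "j \<in> {1..m}" "l \<le> n - v" for j l
  proof (rule psd_on_subset[OF _ _ finite_multi_indices])
    have "psd_on (multi_indices (n - half_degree ((g(0 := 1)) j))) (localizing_matrix ((g(0 := 1)) j) \<phi>)"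
      using feas that(1) unfolding relaxation_feasible_def by (metis atLeastAtMost_iff le0)
    then show "psd_on (multi_indices (n - half_degree (g j))) (localizing_matrix (g j) \<phi>)"
      using that by simp
    show "multi_indices l \<subseteq> multi_indices (n - half_degree (g j))"
      using hd[OF that(1)] that(2) by (auto simp: multi_indices_def)
  qed
  have lower: "riesz \<phi> f \<le> poly_eval f x" if "x \<in> feasible_set g m" for x
    using opt[OF relaxation_feasible_dirac[OF that]] by (simp add: poly_eval_eq_riesz)
  \<comment> \<open>With \<open>r l\<close> atoms, polynomials of degree at most \<open>l\<close>
    interpolate at them. Testing \<open>g j\<close>, of degree at most \<open>2 * v\<close>, against
    their squares involves moments up to degree \<open>2 * v + 2 * l\<close>.\<close>
  have supp: "set_pmf \<mu> \<subseteq> feasible_set g m"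
    if "represents N \<phi> \<mu>" "r l = card (set_pmf \<mu>)" "l \<le> n - v" "2 * v + 2 * l \<le> N" for \<mu> N l
    unfolding feasible_set_def
  proof safe
    fix x j assume x: "x \<in> set_pmf \<mu>" and j: "j \<in> {1..m}"
    have "total_degree (g j) + 2 * l \<le> N"
      using hd[OF j] total_degree_le_half_degree[of "g j"] that by linarith
    then show "0 \<le> poly_eval (g j) x"
      using that x psd_g[OF j] by (intro nonneg_at_atoms[of N \<phi> \<mu> l]) (auto simp: r_def)
  qed
  have mono: "r i \<le> r j" if "i \<le> j" "j \<le> n" for i j
    unfolding r_def by (rule moment_rank_mono[OF that])

  \<comment> \<open>Growth of the ranks and feasibility of the atoms\<close>
  define s where "s = (LEAST j. r j = r k)"
  have s: "r s = r k" "s \<le> k"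
    unfolding s_def by (rule LeastI[of _ k], simp) (rule Least_le, simp)
  \<comment> \<open>An earlier repetition would propagate up to order \<open>k\<close> and
    contradict the minimality of \<open>s\<close>.\<close>
  have strict: "r j \<noteq> r (Suc j)" if "j < s" for j
  proof
    assume "r j = r (Suc j)"
    then have "r k = r j"
      using moment_rank_propagate[of j k] that s n by (simp add: r_def)
    then show False using that not_less_Least[of j "\<lambda>j. r j = r k"] by (simp add: s_def)
  qed
  have grow: "Suc j \<le> r j" if "j \<le> s" for j
    unfolding r_def using that s n strict by (intro rank_strict_ge one) (auto simp: r_def)
  have rn: "r n \<le> n - v + 1" using assms(6) by (simp add: r_def)
  \<comment> \<open>If \<open>s = k > 0\<close> and \<open>r k < r n\<close>, then
    \<open>r k \<le> n - v \<le> k + 1\<close>, while strict growth gives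
    \<open>k \<le> r (k - 1)\<close>. If \<open>s < k\<close>, the ranks of orders
    \<open>k - 1\<close> and \<open>k\<close> agree.\<close>
  have rank_cond: "r k = r n \<or> k = 0 \<or> r k \<le> Suc (r (k - 1))"
  proof (cases "s = k")
    case True
    then show ?thesis
      using grow[of "k - 1"] mono[of k n] rn n by (cases "r k = r n"; cases "k = 0") auto
  next
    case False
    then have "s \<le> k - 1" "k - 1 \<le> n" using s n by auto
    then show ?thesis using mono[of s "k - 1"] s by simp
  qed
  then obtain \<mu> where mu: "represents (k + n) \<phi> \<mu>" "card (set_pmf \<mu>) = r k"
    "r k = r n \<Longrightarrow> represents (2 * n) \<phi> \<mu>"
    using representing_measure_if_rank[OF n(1) one] unfolding r_def by blast
  \<comment> \<open>From \<open>s + 1 \<le> r s = r k \<le> r n \<le> n - v + 1\<close>; the case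
    \<open>s = n - v\<close> makes all of these equal.\<close>
  have s_bound: "s < n - v \<or> s = n - v \<and> r k = r n"
    using grow[of s] s mono[of k n] rn n by auto
  \<comment> \<open>Testing at order \<open>s\<close> involves moments up to degree
    \<open>2 * v + 2 * s\<close>. This is at most \<open>2 * n - 2\<close> if
    \<open>s < n - v\<close>; otherwise it is \<open>2 * n\<close>, and \<open>r k = r n\<close>
    provides these moments.\<close>
  have mu_supp: "set_pmf \<mu> \<subseteq> feasible_set g m"
  proof (cases "s < n - v")
    case True
    then show ?thesis using supp[OF mu(1), of s] s mu(2) n by simp
  next
    case False
    then show ?thesis using supp[OF mu(3), of s] s_bound s mu(2) assms(3) by simp
  qed
  have f: "total_degree f \<le> k + n" using assms(4) n by linarith
  obtain x where x: "x \<in> set_pmf \<mu>" using set_pmf_not_empty[of \<mu>] by blast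
  note min = atoms_global_minimizers[OF mu(1) f mu_supp lower x]

  \<comment> \<open>Equality of the optimal values\<close>
  have "pop_value f g m = ereal (riesz \<phi> f)"
    unfolding pop_value_def
  proof (rule antisym)
    show "(INF x\<in>feasible_set g m. ereal (poly_eval f x)) \<le> ereal (riesz \<phi> f)"
      using x mu_supp min(1) by (intro INF_lower2[of x]) auto
    show "ereal (riesz \<phi> f) \<le> (INF x\<in>feasible_set g m. ereal (poly_eval f x))"
      using lower by (intro INF_greatest) auto
  qed
  moreover have "relaxation_value n f g m = ereal (riesz \<phi> f)"
    unfolding relaxation_value_def
  proof (rule antisym)
    show "(INF \<phi>\<in>{\<phi>. relaxation_feasible n g m \<phi>}. ereal (riesz \<phi> f)) \<le> ereal (riesz \<phi> f)"
      using feas by (intro INF_lower) auto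
    show "ereal (riesz \<phi> f) \<le> (INF \<phi>\<in>{\<phi>. relaxation_feasible n g m \<phi>}. ereal (riesz \<phi> f))"
      using opt by (intro INF_greatest) auto
  qed

  \<comment> \<open>Recovery of minimizers for quadratic data\<close>
  moreover have "\<exists>k. 1 \<le> k \<and> k \<le> n \<and> flat_moments v k \<phi> \<and> (\<exists>\<mu>. atomic_representing k \<phi> \<mu>) \<and>
      (\<forall>\<mu>. atomic_representing k \<phi> \<mu> \<longrightarrow> (\<forall>x\<in>set_pmf \<mu>. global_minimizer f g m x))"
    if quad: "total_degree f \<le> 2" "\<forall>j\<in>{1..m}. total_degree (g j) \<le> 2"
  proof -
    have "half_degree (g j) \<le> 1" if "j \<in> {1..m}" for j
      using quad(2) that by (force simp: half_degree_def)
    \<comment> \<open>The value \<open>v = 0\<close> occurs when all constraint polynomials are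
      constant.\<close>
    then have v1: "v \<le> 1"
      unfolding assms(2) max_half_degree_def using assms(1) by (subst Max_le_iff) auto
    \<comment> \<open>The order \<open>n\<close> serves if \<open>r k = r n\<close>, and
      \<open>k\<close> otherwise. For \<open>k = 0\<close> the order must still be positive, and the
      two-atom measure of order 1 takes over.\<close>
    have "\<exists>l. 1 \<le> l \<and> l \<le> n \<and> v \<le> l \<and> r l = r (l - v) \<and>
        (\<exists>\<mu>. represents (2 * l) \<phi> \<mu> \<and> card (set_pmf \<mu>) = r l)"
    proof (cases "r k = r n")
      case True
      have "n - v = n \<or> n - v = k" using v1 n by auto
      then have "r n = r (n - v)" using True by auto
      then show ?thesis using True mu n assms(3) by (intro exI[of _ n]) auto
    next
      case False
      show ?thesis
      proof (cases "k = 0")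
        case True
        \<comment> \<open>With \<open>r k < r n\<close> only \<open>s < n - v\<close> remains, which
          reads \<open>0 < 1 - v\<close>.\<close>
        have "v = 0"
          using s_bound False s(2) True n by auto
        moreover have "r n = 2"
          using False rn mono[of k n] grow[of 0] True n \<open>v = 0\<close> s by auto
        ultimately show ?thesis
          using representing_measure_order_1 one True n by (intro exI[of _ 1]) (auto simp: r_def)
      next
        case k0: False
        have "r k = r (k - v)"
        proof (cases "v = 0")
          case False
          then have "v = 1" using v1 by simp
          \<comment> \<open>The rank has reached its value at order \<open>k\<close> by order
            \<open>k - 1\<close>, which is flatness at \<open>k\<close> for
            \<open>v = 1\<close>.\<close>
          then have "s \<le> k - 1" using s_bound \<open>r k \<noteq> r n\<close> n by auto
          then show ?thesis using mono[of s "k - 1"] mono[of "k - 1" k] s n \<open>v = 1\<close> by simp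
        qed simp
        then show ?thesis
          using mu k0 n v1 by (intro exI[of _ k]) (auto intro!: exI[of _ \<mu>] represents_mono[OF mu(1)])
      qed
    qed
    then obtain l \<nu> where l: "1 \<le> l" "l \<le> n" "v \<le> l" "r l = r (l - v)"
      and nu: "represents (2 * l) \<phi> \<nu>" "card (set_pmf \<nu>) = r l" by blast
    \<comment> \<open>By flatness any such measure has \<open>r (l - v)\<close> atoms, so testing
      the constraints at order \<open>l - v\<close> involves moments up to degree
      \<open>2 * l\<close> only.\<close>
    have "global_minimizer f g m y"
      if at: "atomic_representing l \<phi> \<mu>'" and y: "y \<in> set_pmf \<mu>'" for \<mu>' y
    proof -
      have rep: "represents (2 * l) \<phi> \<mu>'" and card: "card (set_pmf \<mu>') = r l"
        using at by (auto simp: atomic_representing_def represents_def r_def)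
      have "set_pmf \<mu>' \<subseteq> feasible_set g m"
        using supp[OF rep, of "l - v"] card l by auto
      then show ?thesis
        using atoms_global_minimizers(2)[OF rep _ _ lower y] quad(1) l(1) by simp
    qed
    moreover have "atomic_representing l \<phi> \<nu>"
      using nu by (auto simp: atomic_representing_def represents_def r_def)
    moreover have "flat_moments v l \<phi>" using l by (simp add: flat_moments_def r_def)
    ultimately show ?thesis using l by blast
  qed
  ultimately show ?thesis using min(2) by auto
qed

end
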